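(* Let $\Lambda$ be an alphabet and let $\mathcal{F} \subseteq \mathsf{FO}^2[<]$ be a fragment. For all $\sigma$-rational words $u, v$ over $\Lambda$ the following are equivalent: (1) for every sentence $\varphi \in \mathcal{F}$, $u \models \varphi$ implies $v \models \varphi$; (2) Duplicator has a winning strategy in the $\mathcal{F}$-game on $(u,v)$.
   Context: \textbf{Generalized words.} A (generalized) word over $\Lambda$ is a triple $w=(P_w,\leq_w,l_w)$ with $P_w=\mathrm{dom}(w)$ a set, $\leq_w$ a linear order on it and $l_w:P_w\to\Lambda$ a labeling; we write $w(p)=l_w(p)$. Words are identified up to label-preserving order isomorphism; only countable words are considered. A finite word $a_1\cdots a_n$ has domain $\{1,\dots,n\}$ with the natural order. Concatenation $uv$ places $\mathrm{dom}(u)$ before $\mathrm{dom}(v)$. For a linear order $(T,\leq_T)$ of type $\tau$, the power $w^\tau$ has domain $\mathrm{dom}(w)\times T$, ordered by $(p,t)\le(p',t')$ iff $t<_T t'$, or $t=t'$ and $p\le_w p'$, with label $w^\tau(p,t)=w(p)$. Let $\omega,\zeta,\omega^*$ be the order types of $\mathbb{N}$, $\mathbb{Z}$, $-\mathbb{N}$ (natural order), and $\sigma=\omega+\zeta+\omega^*$ (the order type of $\mathbb{N}\uplus\mathbb{Z}\uplus-\mathbb{N}$, with the $\mathbb{N}$-part first, then the $\mathbb{Z}$-part, then the $-\mathbb{N}$-part). A word is $\sigma$-rational if it can be built from finite words using only concatenation and $\sigma$-power. \textbf{Logic.} $\mathsf{FO}$ is the set of formulas given by $\varphi ::= \top\mid\bot\mid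 x=y\mid \lambda(x)=a\mid x<y\mid x\le y\mid \neg\varphi\mid\varphi\lor\varphi\mid\varphi\land\varphi\mid\exists x\,\varphi\mid\forall x\,\varphi$ with variables from a countably infinite set $\mathbb{V}$ and $a\in\Lambda$. For a finite $V\subseteq\mathbb{V}$, a $V$-valuation $\langle w,\alpha\rangle$ is a word $w$ with a map $\alpha:V\to\mathrm{dom}(w)$; satisfaction $\langle w,\alpha\rangle\models\varphi$ (for $\mathrm{FV}(\varphi)\subseteq V$) is the usual one, with $\lambda(x)=a$ meaning the position of $x$ has label $a$, and $<,\le$ interpreted by the order of $w$. For a sentence, $w\models\varphi$ means $\langle w,\emptyset\rangle\models\varphi$. $\mathsf{FO}^2[<]$ is the set of formulas of $\mathsf{FO}$ using only the variables $x,y$. $\mathrm{qd}$ denotes quantifier depth. \textbf{Fragments.} A context is a formula in which a special constant predicate $\circ$ occurs exactly once; $\mu(\varphi)$ denotes the result of replacing $\circ$ by $\varphi$. A fragment is a nonempty $\mathcal{F}\subseteq\mathsf{FO}$ such that for all contexts $\mu$, formulas $\varphi,\psi$, $a\in\Lambda$, $x,y\in\mathbb{V}$: (i) if $\mu(\varphi)\in\mathcal{F}$ then $\mu(\top),\mu(\bot),\mu(\lambda(x)=a)\in\mathcal{F}$; (ii) $\mu(\varphi\lor\psi)\in\mathcal{F}$ iff $\mu(\varphi),\mu(\psi)\in\mathcal{F}$; (iii) same for $\land$; (iv) if $\mu(\neg\neg\varphi)\in\mathcal{F}$ then $\mu(\varphi)\in\mathcal{F}$; (v) if $\mu(\exists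 x\,\varphi)\in\mathcal{F}$ and $x\notin\mathrm{FV}(\varphi)$ then $\mu(\varphi)\in\mathcal{F}$; (vi) same for $\forall$; (vii) $\mu(x<y)\in\mathcal{F}$ iff $\mu(x\le y)\in\mathcal{F}$. \textbf{Games.} Quantifiers are $\mathcal{Q}=\{\exists,\forall,\neg\exists,\neg\forall\}$; the reduct of $\mathcal{G}$ by $\mathsf{Q}x$ is $\{\varphi : \mathsf{Q}x\,\varphi\in\mathcal{G}\}$. A configuration of the $\mathcal{F}$-game is $(\mathcal{G},\langle u,\alpha\rangle,\langle v,\beta\rangle)$ with $\mathcal{G}$ a nonempty iterated reduct of $\mathcal{F}$ and $\langle u,\alpha\rangle,\langle v,\beta\rangle$ $V$-valuations for a common finite $V$. The $\mathcal{F}$-game on $(u,v)$ starts in $(\mathcal{F},\langle u,\emptyset\rangle,\langle v,\emptyset\rangle)$. In a round from $(\mathcal{G},\langle u,\alpha\rangle,\langle v,\beta\rangle)$, Spoiler chooses $\mathsf{Q}\in\mathcal{Q}$ and $x\in\mathbb{V}$ with nonempty reduct $\mathcal{G}'$ of $\mathcal{G}$ by $\mathsf{Q}x$, and a quest $q$; Duplicator answers $r$. If $\mathsf{Q}=\exists$: $q\in\mathrm{dom}(u)$, $r\in\mathrm{dom}(v)$, new configuration $(\mathcal{G}',\langle u,\alpha[x\mapsto q]\rangle,\langle v,\beta[x\mapsto r]\rangle)$. If $\mathsf{Q}=\forall$: $q\in\mathrm{dom}(v)$, $r\in\mathrm{dom}(u)$, new configuration $(\mathcal{G}',\langle u,\alpha[x\mapsto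 r]\rangle,\langle v,\beta[x\mapsto q]\rangle)$. If $\mathsf{Q}=\neg\exists$: $q\in\mathrm{dom}(v)$, $r\in\mathrm{dom}(u)$, new configuration $(\mathcal{G}',\langle v,\beta[x\mapsto q]\rangle,\langle u,\alpha[x\mapsto r]\rangle)$ (the words swap roles). If $\mathsf{Q}=\neg\forall$: $q\in\mathrm{dom}(u)$, $r\in\mathrm{dom}(v)$, new configuration $(\mathcal{G}',\langle v,\beta[x\mapsto r]\rangle,\langle u,\alpha[x\mapsto q]\rangle)$. Winning: if Spoiler cannot choose any $\mathsf{Q},x$ with nonempty reduct, Duplicator wins; if a player must choose a position in an empty domain, the other player wins; if a configuration $(\mathcal{G},\langle u,\alpha\rangle,\langle v,\beta\rangle)$ (with $V$-valuations) is reached such that some quantifier-free $\varphi\in\mathcal{G}$ with $\mathrm{FV}(\varphi)\subseteq V$ satisfies $\langle u,\alpha\rangle\models\varphi$ but $\langle v,\beta\rangle\not\models\varphi$, Spoiler wins; in all other cases (including infinite plays) Duplicator wins. The game stops as soon as someone has won. *)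

theory Defs
  imports Main
begin

section \<open>Generalized words\<close>

record ('p, 'a) word =
  positions :: "'p set"
  le :: "'p rel"
  lab :: "'p \<Rightarrow> 'a"

definition is_word :: "('p, 'a) word \<Rightarrow> bool" where
  "is_word w \<longleftrightarrow> linear_order_on (positions w) (le w)"

definition word_iso :: "('p, 'a) word \<Rightarrow> ('q, 'a) word \<Rightarrow> bool" where
  "word_iso u v \<longleftrightarrow> is_word u \<and> is_word v \<and>
     (\<exists>f. bij_betw f (positions u) (positions v) \<and>
        (\<forall>p\<in>positions u. \<forall>q\<in>positions u. (p, q) \<in> le u \<longleftrightarrow> (f p, f q) \<in> le v) \<and>
        (\<forall>p\<in>positions u. lab v (f p) = lab u p))"

definition finite_word :: "'a list \<Rightarrow> (nat, 'a) word" where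
  "finite_word as =
     \<lparr>positions = {1..length as},
      le = {(i, j). 1 \<le> i \<and> i \<le> j \<and> j \<le> length as},
      lab = (\<lambda>i. as ! (i - 1))\<rparr>"

text \<open>A reflexive linear order \<open>r\<close> stands for the linearly ordered set with carrier \<open>Field r\<close>.\<close>

definition order_sum :: "'p rel \<Rightarrow> 'q rel \<Rightarrow> ('p + 'q) rel" where
  "order_sum r s =
     {(Inl p, Inl p') | p p'. (p, p') \<in> r} \<union>
     {(Inr q, Inr q') | q q'. (q, q') \<in> s} \<union>
     {(Inl p, Inr q) | p q. p \<in> Field r \<and> q \<in> Field s}"

definition word_concat :: "('p, 'a) word \<Rightarrow> ('q, 'a) word \<Rightarrow> ('p + 'q, 'a) word" where
  "word_concat u v =
     \<lparr>positions = positions u <+> positions v,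
      le = order_sum (le u) (le v),
      lab = case_sum (lab u) (lab v)\<rparr>"

definition word_power :: "('p, 'a) word \<Rightarrow> 't rel \<Rightarrow> ('p \<times> 't, 'a) word" where
  "word_power w r =
     \<lparr>positions = positions w \<times> Field r,
      le = {((p, t), (p', t')).
              p \<in> positions w \<and> p' \<in> positions w \<and> t \<in> Field r \<and> t' \<in> Field r \<and>
              ((t, t') \<in> r \<and> t \<noteq> t' \<or> t = t' \<and> (p, p') \<in> le w)},
      lab = (\<lambda>(p, t). lab w p)\<rparr>"

definition omega :: "nat rel" where
  "omega = {(m, n). m \<le> n}"

definition zeta :: "int rel" where
  "zeta = {(m, n). m \<le> n}"

definition omega_star :: "int rel" where
  "omega_star = {(m, n). m \<le> n \<and> n \<le> 0}"

definition sigma :: "(nat + int + int) rel" where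
  "sigma = order_sum omega (order_sum zeta omega_star)"

text \<open>
  Words are considered up to isomorphism, and every countable word is isomorphic to one whose
  positions are natural numbers. Each rule therefore admits all isomorphic copies over the
  position type \<open>nat\<close>. The empty word counts as a finite word.
\<close>

inductive sigma_rational :: "(nat, 'a) word \<Rightarrow> bool" where
  finite: "word_iso (finite_word as) w \<Longrightarrow> sigma_rational w"
| concat: "sigma_rational u \<Longrightarrow> sigma_rational v \<Longrightarrow> word_iso (word_concat u v) w \<Longrightarrow> sigma_rational w"
| power: "sigma_rational u \<Longrightarrow> word_iso (word_power u sigma) w \<Longrightarrow> sigma_rational w"


section \<open>First-order logic over words\<close>

type_synonym var = nat

datatype 'a fm =
    Top
  | Bot
  | Eq var var
  | Lab var 'a
  | Less var var
  | LessEq var var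
  | Neg "'a fm"
  | Disj "'a fm" "'a fm"
  | Conj "'a fm" "'a fm"
  | Ex var "'a fm"
  | All var "'a fm"

primrec FV :: "'a fm \<Rightarrow> var set" where
  "FV Top = {}"
| "FV Bot = {}"
| "FV (Eq x y) = {x, y}"
| "FV (Lab x a) = {x}"
| "FV (Less x y) = {x, y}"
| "FV (LessEq x y) = {x, y}"
| "FV (Neg \<phi>) = FV \<phi>"
| "FV (Disj \<phi> \<psi>) = FV \<phi> \<union> FV \<psi>"
| "FV (Conj \<phi> \<psi>) = FV \<phi> \<union> FV \<psi>"
| "FV (Ex x \<phi>) = FV \<phi> - {x}"
| "FV (All x \<phi>) = FV \<phi> - {x}"

text \<open>All variables occurring in a formula, whether free, bound or merely quantified.\<close>

primrec vars :: "'a fm \<Rightarrow> var set" where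
  "vars Top = {}"
| "vars Bot = {}"
| "vars (Eq x y) = {x, y}"
| "vars (Lab x a) = {x}"
| "vars (Less x y) = {x, y}"
| "vars (LessEq x y) = {x, y}"
| "vars (Neg \<phi>) = vars \<phi>"
| "vars (Disj \<phi> \<psi>) = vars \<phi> \<union> vars \<psi>"
| "vars (Conj \<phi> \<psi>) = vars \<phi> \<union> vars \<psi>"
| "vars (Ex x \<phi>) = insert x (vars \<phi>)"
| "vars (All x \<phi>) = insert x (vars \<phi>)"

primrec quantifier_free :: "'a fm \<Rightarrow> bool" where
  "quantifier_free Top = True"
| "quantifier_free Bot = True"
| "quantifier_free (Eq x y) = True"
| "quantifier_free (Lab x a) = True"
| "quantifier_free (Less x y) = True"
| "quantifier_free (LessEq x y) = True"
| "quantifier_free (Neg \<phi>) = quantifier_free \<phi>"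
| "quantifier_free (Disj \<phi> \<psi>) = (quantifier_free \<phi> \<and> quantifier_free \<psi>)"
| "quantifier_free (Conj \<phi> \<psi>) = (quantifier_free \<phi> \<and> quantifier_free \<psi>)"
| "quantifier_free (Ex x \<phi>) = False"
| "quantifier_free (All x \<phi>) = False"

text \<open>
  A \<open>V\<close>-valuation \<open>\<langle>w, \<alpha>\<rangle>\<close> has \<open>V = dom \<alpha>\<close>; satisfaction is meaningful only when
  \<open>FV \<phi> \<subseteq> dom \<alpha>\<close>.
\<close>

type_synonym ('p, 'a) valuation = "('p, 'a) word \<times> (var \<rightharpoonup> 'p)"

primrec sat :: "('p, 'a) word \<Rightarrow> (var \<rightharpoonup> 'p) \<Rightarrow> 'a fm \<Rightarrow> bool" where
  "sat w \<alpha> Top \<longleftrightarrow> True"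
| "sat w \<alpha> Bot \<longleftrightarrow> False"
| "sat w \<alpha> (Eq x y) \<longleftrightarrow> the (\<alpha> x) = the (\<alpha> y)"
| "sat w \<alpha> (Lab x a) \<longleftrightarrow> lab w (the (\<alpha> x)) = a"
| "sat w \<alpha> (Less x y) \<longleftrightarrow> (the (\<alpha> x), the (\<alpha> y)) \<in> le w \<and> the (\<alpha> x) \<noteq> the (\<alpha> y)"
| "sat w \<alpha> (LessEq x y) \<longleftrightarrow> (the (\<alpha> x), the (\<alpha> y)) \<in> le w"
| "sat w \<alpha> (Neg \<phi>) \<longleftrightarrow> \<not> sat w \<alpha> \<phi>"
| "sat w \<alpha> (Disj \<phi> \<psi>) \<longleftrightarrow> sat w \<alpha> \<phi> \<or> sat w \<alpha> \<psi>"
| "sat w \<alpha> (Conj \<phi> \<psi>) \<longleftrightarrow> sat w \<alpha> \<phi> \<and> sat w \<alpha> \<psi>"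
| "sat w \<alpha> (Ex x \<phi>) \<longleftrightarrow> (\<exists>p\<in>positions w. sat w (\<alpha>(x \<mapsto> p)) \<phi>)"
| "sat w \<alpha> (All x \<phi>) \<longleftrightarrow> (\<forall>p\<in>positions w. sat w (\<alpha>(x \<mapsto> p)) \<phi>)"

definition models :: "('p, 'a) word \<Rightarrow> 'a fm \<Rightarrow> bool" where
  "models w \<phi> \<longleftrightarrow> sat w Map.empty \<phi>"

definition FO2 :: "var \<Rightarrow> var \<Rightarrow> 'a fm set" where
  "FO2 x y = {\<phi>. vars \<phi> \<subseteq> {x, y}}"


section \<open>Fragments\<close>

datatype 'a ctx =
    Hole
  | CNeg "'a ctx"
  | CDisjL "'a ctx" "'a fm"
  | CDisjR "'a fm" "'a ctx"
  | CConjL "'a ctx" "'a fm"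
  | CConjR "'a fm" "'a ctx"
  | CEx var "'a ctx"
  | CAll var "'a ctx"

text \<open>Filling the hole may capture free variables.\<close>

primrec fill :: "'a ctx \<Rightarrow> 'a fm \<Rightarrow> 'a fm" where
  "fill Hole \<phi> = \<phi>"
| "fill (CNeg \<mu>) \<phi> = Neg (fill \<mu> \<phi>)"
| "fill (CDisjL \<mu> \<psi>) \<phi> = Disj (fill \<mu> \<phi>) \<psi>"
| "fill (CDisjR \<psi> \<mu>) \<phi> = Disj \<psi> (fill \<mu> \<phi>)"
| "fill (CConjL \<mu> \<psi>) \<phi> = Conj (fill \<mu> \<phi>) \<psi>"
| "fill (CConjR \<psi> \<mu>) \<phi> = Conj \<psi> (fill \<mu> \<phi>)"
| "fill (CEx x \<mu>) \<phi> = Ex x (fill \<mu> \<phi>)"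
| "fill (CAll x \<mu>) \<phi> = All x (fill \<mu> \<phi>)"

text \<open>
  The parameter \<open>X\<close> is the set of variables of the ambient logic: \<open>X = UNIV\<close> for full
  first-order logic and \<open>X = {x, y}\<close> for its two-variable fragment \<open>FO2 x y\<close>. It matters only
  for the label atoms in the first closure condition. With \<open>X = UNIV\<close> that condition (for the
  trivial context) puts \<open>Lab z a\<close> into \<open>F\<close> for every variable \<open>z\<close>, so no subset of \<open>FO2 x y\<close>
  could satisfy it.
\<close>

definition fragment :: "var set \<Rightarrow> 'a fm set \<Rightarrow> bool" where
  "fragment X F \<longleftrightarrow> F \<noteq> {} \<and>
     (\<forall>\<mu> \<phi>. fill \<mu> \<phi> \<in> F \<longrightarrow>
        fill \<mu> Top \<in> F \<and> fill \<mu> Bot \<in> F \<and> (\<forall>x\<in>X. \<forall>a. fill \<mu> (Lab x a) \<in> F)) \<and>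
     (\<forall>\<mu> \<phi> \<psi>. fill \<mu> (Disj \<phi> \<psi>) \<in> F \<longleftrightarrow> fill \<mu> \<phi> \<in> F \<and> fill \<mu> \<psi> \<in> F) \<and>
     (\<forall>\<mu> \<phi> \<psi>. fill \<mu> (Conj \<phi> \<psi>) \<in> F \<longleftrightarrow> fill \<mu> \<phi> \<in> F \<and> fill \<mu> \<psi> \<in> F) \<and>
     (\<forall>\<mu> \<phi>. fill \<mu> (Neg (Neg \<phi>)) \<in> F \<longrightarrow> fill \<mu> \<phi> \<in> F) \<and>
     (\<forall>\<mu> x \<phi>. fill \<mu> (Ex x \<phi>) \<in> F \<and> x \<notin> FV \<phi> \<longrightarrow> fill \<mu> \<phi> \<in> F) \<and>
     (\<forall>\<mu> x \<phi>. fill \<mu> (All x \<phi>) \<in> F \<and> x \<notin> FV \<phi> \<longrightarrow> fill \<mu> \<phi> \<in> F) \<and>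
     (\<forall>\<mu> x y. fill \<mu> (Less x y) \<in> F \<longleftrightarrow> fill \<mu> (LessEq x y) \<in> F)"


section \<open>The game\<close>

datatype quant = QEx | QAll | QNegEx | QNegAll

primrec quantify :: "quant \<Rightarrow> var \<Rightarrow> 'a fm \<Rightarrow> 'a fm" where
  "quantify QEx x \<phi> = Ex x \<phi>"
| "quantify QAll x \<phi> = All x \<phi>"
| "quantify QNegEx x \<phi> = Neg (Ex x \<phi>)"
| "quantify QNegAll x \<phi> = Neg (All x \<phi>)"

definition reduct :: "quant \<Rightarrow> var \<Rightarrow> 'a fm set \<Rightarrow> 'a fm set" where
  "reduct Q x G = {\<phi>. quantify Q x \<phi> \<in> G}"

type_synonym ('p, 'a) config = "'a fm set \<times> ('p, 'a) valuation \<times> ('p, 'a) valuation"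

fun spoiler_won :: "('p, 'a) config \<Rightarrow> bool" where
  "spoiler_won (G, (u, \<alpha>), (v, \<beta>)) \<longleftrightarrow>
     (\<exists>\<phi>\<in>G. quantifier_free \<phi> \<and> FV \<phi> \<subseteq> dom \<alpha> \<and> sat u \<alpha> \<phi> \<and> \<not> sat v \<beta> \<phi>)"

text \<open>A challenge is Spoiler's choice of quantifier, variable and quest in one round.\<close>

type_synonym 'p challenge = "quant \<times> var \<times> 'p"

fun legal_challenge :: "('p, 'a) config \<Rightarrow> 'p challenge \<Rightarrow> bool" where
  "legal_challenge (G, (u, \<alpha>), (v, \<beta>)) (Q, x, q) \<longleftrightarrow>
     reduct Q x G \<noteq> {} \<and>
     (case Q of
        QEx \<Rightarrow> q \<in> positions u
      | QAll \<Rightarrow> q \<in> positions v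
      | QNegEx \<Rightarrow> q \<in> positions v
      | QNegAll \<Rightarrow> q \<in> positions u)"

fun legal_answer :: "('p, 'a) config \<Rightarrow> 'p challenge \<Rightarrow> 'p \<Rightarrow> bool" where
  "legal_answer (G, (u, \<alpha>), (v, \<beta>)) (Q, x, q) r \<longleftrightarrow>
     (case Q of
        QEx \<Rightarrow> r \<in> positions v
      | QAll \<Rightarrow> r \<in> positions u
      | QNegEx \<Rightarrow> r \<in> positions u
      | QNegAll \<Rightarrow> r \<in> positions v)"

fun next_config :: "('p, 'a) config \<Rightarrow> 'p challenge \<Rightarrow> 'p \<Rightarrow> ('p, 'a) config" where
  "next_config (G, (u, \<alpha>), (v, \<beta>)) (Q, x, q) r =
     (case Q of
        QEx \<Rightarrow> (reduct Q x G, (u, \<alpha>(x \<mapsto> q)), (v, \<beta>(x \<mapsto> r)))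
      | QAll \<Rightarrow> (reduct Q x G, (u, \<alpha>(x \<mapsto> r)), (v, \<beta>(x \<mapsto> q)))
      | QNegEx \<Rightarrow> (reduct Q x G, (v, \<beta>(x \<mapsto> q)), (u, \<alpha>(x \<mapsto> r)))
      | QNegAll \<Rightarrow> (reduct Q x G, (v, \<beta>(x \<mapsto> r)), (u, \<alpha>(x \<mapsto> q))))"

definition initial_config ::
    "'a fm set \<Rightarrow> ('p, 'a) word \<Rightarrow> ('p, 'a) word \<Rightarrow> ('p, 'a) config" where
  "initial_config F u v = (F, (u, Map.empty), (v, Map.empty))"

text \<open>
  A strategy for Duplicator maps the rounds played so far and Spoiler's current challenge to an
  answer. \<open>play s F u v h c\<close> says that, with Duplicator following \<open>s\<close>, the rounds \<open>h\<close>
  can be played in the \<open>F\<close>-game on \<open>(u, v)\<close> and lead to the configuration \<open>c\<close>.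
\<close>

type_synonym 'p strategy = "('p challenge \<times> 'p) list \<Rightarrow> 'p challenge \<Rightarrow> 'p"

inductive play ::
    "'p strategy \<Rightarrow> 'a fm set \<Rightarrow> ('p, 'a) word \<Rightarrow> ('p, 'a) word \<Rightarrow>
     ('p challenge \<times> 'p) list \<Rightarrow> ('p, 'a) config \<Rightarrow> bool"
  for s F u v where
  start: "play s F u v [] (initial_config F u v)"
| round: "play s F u v h c \<Longrightarrow> \<not> spoiler_won c \<Longrightarrow> legal_challenge c m \<Longrightarrow>
     legal_answer c m (s h m) \<Longrightarrow> play s F u v (h @ [(m, s h m)]) (next_config c m (s h m))"

text \<open>
  Spoiler can only win after finitely many rounds: by reaching a configuration with
  \<open>spoiler_won\<close>, or by a challenge that Duplicator must answer in an empty domain. A strategy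
  that excludes both wins all other plays for Duplicator: infinite ones, and those in which Spoiler
  has no nonempty reduct available or chooses a quantifier whose quest domain is empty.
\<close>

definition winning_strategy ::
    "'a fm set \<Rightarrow> ('p, 'a) word \<Rightarrow> ('p, 'a) word \<Rightarrow> 'p strategy \<Rightarrow> bool" where
  "winning_strategy F u v s \<longleftrightarrow>
     (\<forall>h c. play s F u v h c \<longrightarrow>
        \<not> spoiler_won c \<and> (\<forall>m. legal_challenge c m \<longrightarrow> legal_answer c m (s h m)))"

end

theory Submission
  imports Defs "HOL-Library.Infinite_Set"
begin

text \<open>
  A unary two-variable type of a position only records its label and which types occur to its left
  and to its right, so types of bounded rank are captured by a back-and-forth relation \<open>sim\<close>
  between single positions. Since a two-variable formula sees at most one other position, Duplicator
  only needs the following saturation property of the words: for every position \<open>p\<close>, the set of types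
  realised to the left (right) of \<open>p\<close> is topologically closed. It passes through
  concatenations and \<open>\<sigma>\<close>-powers, because in \<open>\<sigma>\<close> a sequence running off to the end of the
  \<open>\<omega>\<close>-part or to the start of the \<open>\<omega>\<^sup>*\<close>-part converges to the positions of the \<open>\<zeta>\<close>-part. Saturation
  makes two-variable formulas compact, so Duplicator can always answer such that all formulas of the
  current reduct, of whatever quantifier depth, remain preserved.
\<close>

section \<open>Bisimilarity of positions\<close>

text \<open>The obstacle is that \<open>F\<close> may contain formulas of unbounded quantifier
  depth: one answer must preserve infinitely many formulas at once, while the usual argument by
  quantifier depth only supplies an answer for each depth. In the word a^\<omega> the gap is real:
  its positions look more and more like one with infinitely many predecessors, and there is none.
  Compactness is used inside one word at a time. \<open>sim\<close> never compares u with v; these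
  are linked only by formulas of the fragment, which need not be closed under negation. If every
  answer failed, finitely many formulas would already witness this. Their conjunction or disjunction
  lies in the reduct, because fragments are closed under both connectives, and with the quantifier
  put back it is a formula of the previous set \<open>G\<close> that violates preservation
  there.\<close>

definition left :: "('p, 'a) word \<Rightarrow> 'p \<Rightarrow> 'p set" where
  "left w p = {s. (s, p) \<in> le w \<and> s \<noteq> p}"

definition right :: "('p, 'a) word \<Rightarrow> 'p \<Rightarrow> 'p set" where
  "right w p = {s. (p, s) \<in> le w \<and> s \<noteq> p}"

primrec sim :: "('p, 'a) word \<Rightarrow> nat \<Rightarrow> 'p \<Rightarrow> 'p \<Rightarrow> bool" where
  "sim w 0 p q \<longleftrightarrow> lab w p = lab w q"
| "sim w (Suc k) p q \<longleftrightarrow> lab w p = lab w q \<and>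
     rel_set (sim w k) (left w p) (left w q) \<and> rel_set (sim w k) (right w p) (right w q)"

lemma is_word_in_positions:
  assumes "is_word w" "(p, q) \<in> le w"
  shows "p \<in> positions w" "q \<in> positions w"
  using assms
  by (auto simp: is_word_def linear_order_on_def partial_order_on_def preorder_on_def refl_on_def)

lemma left_subset: "is_word w \<Longrightarrow> left w p \<subseteq> positions w"
  and right_subset: "is_word w \<Longrightarrow> right w p \<subseteq> positions w"
  by (auto simp: left_def right_def dest: is_word_in_positions)

lemma is_word_refl: "is_word w \<Longrightarrow> p \<in> positions w \<Longrightarrow> (p, p) \<in> le w"
  by (auto simp: is_word_def linear_order_on_def partial_order_on_def preorder_on_def refl_on_def)

lemma is_word_antisym: "is_word w \<Longrightarrow> (p, q) \<in> le w \<Longrightarrow> (q, p) \<in> le w \<Longrightarrow> p = q"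
  by (auto simp: is_word_def linear_order_on_def partial_order_on_def antisym_def)

lemma positions_split:
  assumes "is_word w" "p \<in> positions w"
  shows "positions w = left w p \<union> {p} \<union> right w p"
proof -
  have "total_on (positions w) (le w)"
    using assms by (auto simp: is_word_def linear_order_on_def)
  then show ?thesis
    using assms left_subset[of w p] right_subset[of w p]
    by (auto simp: left_def right_def total_on_def)
qed

lemma sim_lab: "sim w k p q \<Longrightarrow> lab w p = lab w q"
  by (cases k) auto

lemma sim_refl [simp]: "sim w k p p"
  by (induction k arbitrary: p) (auto simp: rel_set_def)

lemma sim_sym: "sim w k p q \<Longrightarrow> sim w k q p"
proof (induction k arbitrary: p q)
  case (Suc k)
  then show ?case
    unfolding sim.simps rel_set_def by metis
qed simp

lemma sim_trans: "sim w k p q \<Longrightarrow> sim w k q r \<Longrightarrow> sim w k p r"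
proof (induction k arbitrary: p q r)
  case (Suc k)
  have "rel_set (sim w k) A C" if "rel_set (sim w k) A B" "rel_set (sim w k) B C" for A B C
    using that Suc.IH unfolding rel_set_def by metis
  then show ?case
    using Suc.prems by auto
qed simp

lemma sim_Suc: "sim w (Suc k) p q \<Longrightarrow> sim w k p q"
proof (induction k arbitrary: p q)
  case (Suc k)
  have "rel_set (sim w (Suc k)) A B \<Longrightarrow> rel_set (sim w k) A B" for A B
    using Suc.IH unfolding rel_set_def by meson
  then show ?case
    using Suc.prems by (simp only: sim.simps(2)[of w "Suc k" p q] sim.simps(2)[of w k p q])
qed simp

lemma sim_mono: "k \<le> n \<Longrightarrow> sim w n p q \<Longrightarrow> sim w k p q"
  by (induction n rule: dec_induct) (auto dest: sim_Suc simp del: sim.simps)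

section \<open>Finitely many \<open>sim\<close> classes at each rank\<close>

lemma finite_representatives:
  assumes "finite (g ` A)"
    and "\<And>p q. p \<in> A \<Longrightarrow> q \<in> A \<Longrightarrow> g p = g q \<Longrightarrow> R p q"
  shows "\<exists>D. finite D \<and> D \<subseteq> A \<and> (\<forall>p\<in>A. \<exists>d\<in>D. R p d)"
proof (intro exI conjI ballI)
  let ?D = "inv_into A g ` g ` A"
  show "finite ?D" using assms by blast
  show "?D \<subseteq> A" by (auto intro: inv_into_into)
  fix p assume p: "p \<in> A"
  then have "R p (inv_into A g (g p))"
    by (intro assms(2)) (auto intro: inv_into_into simp: f_inv_into_f)
  then show "\<exists>d\<in>?D. R p d" using p by blast
qed

text \<open>The class of a position at rank k + 1 is fixed by its label and by which of the finitely
  many representatives of rank k are met on each side (\<open>?near\<close>).\<close>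

lemma sim_finite_index:
  assumes "finite (lab w ` positions w)" "is_word w"
  shows "\<exists>D. finite D \<and> D \<subseteq> positions w \<and> (\<forall>p\<in>positions w. \<exists>d\<in>D. sim w k p d)"
proof (induction k)
  case 0
  show ?case
    by (rule finite_representatives[of "lab w"]) (use assms in auto)
next
  case (Suc k)
  then obtain D where D: "finite D" "D \<subseteq> positions w"
    "\<And>p. p \<in> positions w \<Longrightarrow> \<exists>d\<in>D. sim w k p d"
    by blast
  let ?near = "\<lambda>A. {d \<in> D. \<exists>s\<in>A. sim w k s d}"
  have near: "rel_set (sim w k) A B"
    if AB: "A \<subseteq> positions w" "B \<subseteq> positions w" "?near A = ?near B" for A B
  proof -
    have *: "\<exists>t\<in>B. sim w k s t"
      if AB: "A \<subseteq> positions w" "?near A = ?near B" "s \<in> A" for A B s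
    proof -
      obtain d where d: "d \<in> D" "sim w k s d" using AB D(3) by blast
      then have "d \<in> ?near B" using AB by blast
      then obtain t where "t \<in> B" "sim w k t d" by blast
      then show ?thesis using sim_trans[OF d(2) sim_sym] by blast
    qed
    show ?thesis
    proof (rule rel_setI)
      show "\<exists>t\<in>B. sim w k s t" if "s \<in> A" for s
        by (rule *[OF AB(1,3) that])
      show "\<exists>s\<in>A. sim w k s t" if "t \<in> B" for t
        using *[OF AB(2) AB(3)[symmetric] that] by (blast intro: sim_sym)
    qed
  qed
  let ?g = "\<lambda>p. (lab w p, ?near (left w p), ?near (right w p))"
  show ?case
  proof (rule finite_representatives[of ?g])
    have "?g ` positions w \<subseteq> lab w ` positions w \<times> Pow D \<times> Pow D"
      by auto
    then show "finite (?g ` positions w)"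
      by (rule finite_subset) (use assms D in auto)
  next
    fix p q assume "?g p = ?g q"
    then show "sim w (Suc k) p q"
      using near[of "left w p" "left w q"] near[of "right w p" "right w q"]
        left_subset[OF assms(2)] right_subset[OF assms(2)]
      by (simp only: sim.simps prod.inject simp_thms)
  qed
qed

section \<open>Saturated words\<close>

text \<open>Sequential compactness for the topology whose basic neighbourhoods of p are its
  \<open>sim w k\<close> classes. A single k bounds both the index and the rank, which loses
  nothing: by \<open>sim_mono\<close> a larger k also serves for smaller ranks.\<close>

definition closed_in :: "('p, 'a) word \<Rightarrow> 'p set \<Rightarrow> bool" where
  "closed_in w A \<longleftrightarrow>
     (\<forall>f::nat \<Rightarrow> 'p. range f \<subseteq> A \<longrightarrow> (\<exists>p\<in>A. \<forall>k. \<exists>n\<ge>k. sim w k (f n) p))"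

text \<open>A variable ranges over all positions if no other one is assigned; if the other one
  stands at p, the order atoms confine it to one side of p or to p itself. Compactness is needed on
  exactly such sets.\<close>

definition saturated :: "('p, 'a) word \<Rightarrow> bool" where
  "saturated w \<longleftrightarrow> closed_in w (positions w) \<and>
     (\<forall>p\<in>positions w. closed_in w (left w p) \<and> closed_in w (right w p))"

lemma closed_in_subsequence:
  assumes "closed_in w A" "infinite {n::nat. f n \<in> A}"
  shows "\<exists>p\<in>A. \<forall>k. \<exists>n\<ge>k. sim w k (f n) p"
proof -
  obtain h :: "nat \<Rightarrow> nat" where h: "strict_mono h" "\<And>n. h n \<in> {n. f n \<in> A}"
    using infinite_enumerate[OF assms(2)] by blast
  have "range (f \<circ> h) \<subseteq> A" using h by auto
  then obtain p where "p \<in> A" and p: "\<forall>k. \<exists>n\<ge>k. sim w k ((f \<circ> h) n) p"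
    using assms(1) unfolding closed_in_def by blast
  \<comment> \<open>Since n \<le> h n, a lower bound on indices of the subsequence is also one on
    indices of f.\<close>
  have "\<exists>n\<ge>k. sim w k (f n) p" for k
    using p h(1) by (metis comp_apply order_trans strict_mono_imp_increasing)
  then show ?thesis using \<open>p \<in> A\<close> by blast
qed

lemma closed_in_union:
  assumes "closed_in w A" "closed_in w B"
  shows "closed_in w (A \<union> B)"
  unfolding closed_in_def
proof (intro allI impI)
  fix f :: "nat \<Rightarrow> _" assume "range f \<subseteq> A \<union> B"
  then have "{n. f n \<in> A} \<union> {n. f n \<in> B} = UNIV" by auto
  then have "infinite {n. f n \<in> A} \<or> infinite {n. f n \<in> B}"
    using infinite_UNIV_nat by (metis finite_UnI)
  then show "\<exists>p\<in>A \<union> B. \<forall>k. \<exists>n\<ge>k. sim w k (f n) p"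
    using closed_in_subsequence assms by blast
qed

text \<open>Some value recurs infinitely often and is its own limit.\<close>

lemma closed_in_finite:
  assumes "finite A"
  shows "closed_in w A"
  unfolding closed_in_def
proof (intro allI impI)
  fix f :: "nat \<Rightarrow> _" assume f: "range f \<subseteq> A"
  then have "finite (range f)" using assms finite_subset by blast
  then obtain m where "infinite {n \<in> UNIV. f n = f m}"
    using pigeonhole_infinite[of UNIV f] by auto
  then have "\<exists>n\<ge>k. f n = f m" for k
    unfolding infinite_nat_iff_unbounded_le by auto
  then have "\<forall>k. \<exists>n\<ge>k. sim w k (f n) (f m)"
    by (metis sim_refl)
  then show "\<exists>p\<in>A. \<forall>k. \<exists>n\<ge>k. sim w k (f n) p"
    using f by blast
qed

text \<open>\<open>L\<close> and \<open>R\<close> are the positions before and after the image of \<open>f\<close>.\<close>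

definition convex_embedding :: "('p \<Rightarrow> 'q) \<Rightarrow> ('p, 'a) word \<Rightarrow> ('q, 'a) word \<Rightarrow> bool" where
  "convex_embedding f u w \<longleftrightarrow>
     (\<forall>p\<in>positions u. lab w (f p) = lab u p) \<and>
     (\<exists>L R. \<forall>p\<in>positions u.
       left w (f p) = L \<union> f ` left u p \<and> right w (f p) = R \<union> f ` right u p)"

lemma rel_set_image_mono:
  assumes "rel_set P A B" "\<And>a b. a \<in> A \<Longrightarrow> b \<in> B \<Longrightarrow> P a b \<Longrightarrow> Q (f a) (f b)" "\<And>c. Q c c"
  shows "rel_set Q (C \<union> f ` A) (C \<union> f ` B)"
  using assms unfolding rel_set_def by blast

text \<open>L and R are the same for all positions of the image, so a move outside the image is
  answered by itself and a move inside it as in u.\<close>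

lemma sim_embedding:
  assumes f: "convex_embedding f u w" and "is_word u"
  shows "p \<in> positions u \<Longrightarrow> q \<in> positions u \<Longrightarrow> sim u k p q \<Longrightarrow> sim w k (f p) (f q)"
proof (induction k arbitrary: p q)
  case 0
  then show ?case using f by (auto simp: convex_embedding_def)
next
  case (Suc k)
  obtain L R where LR: "\<forall>p\<in>positions u.
      left w (f p) = L \<union> f ` left u p \<and> right w (f p) = R \<union> f ` right u p"
    using f unfolding convex_embedding_def by (elim conjE exE)
  have "lab w (f p) = lab w (f q)"
    using f Suc.prems by (auto simp: convex_embedding_def)
  moreover have "rel_set (sim w k) (L \<union> f ` left u p) (L \<union> f ` left u q)"
    "rel_set (sim w k) (R \<union> f ` right u p) (R \<union> f ` right u q)"
    using Suc.prems
    by (auto intro!: rel_set_image_mono[where P = "sim u k"]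
        intro: Suc.IH left_subset[OF assms(2), THEN subsetD] right_subset[OF assms(2), THEN subsetD])
  ultimately show ?case
    using LR Suc.prems by simp
qed

lemma closed_in_embedding:
  assumes f: "convex_embedding f u w" and "is_word u" and A: "closed_in u A" "A \<subseteq> positions u"
  shows "closed_in w (f ` A)"
  unfolding closed_in_def
proof (intro allI impI)
  fix g :: "nat \<Rightarrow> _" assume "range g \<subseteq> f ` A"
  then have "\<forall>n. \<exists>p\<in>A. g n = f p" by blast
  then obtain h where h: "\<And>n. h n \<in> A" "\<And>n. g n = f (h n)" by metis
  then have "range h \<subseteq> A" by blast
  then obtain p where "p \<in> A" "\<forall>k. \<exists>n\<ge>k. sim u k (h n) p"
    using A(1) unfolding closed_in_def by blast
  then have "\<forall>k. \<exists>n\<ge>k. sim w k (g n) (f p)"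
    using sim_embedding[OF f assms(2)] h A(2) by (metis subsetD)
  then show "\<exists>p\<in>f ` A. \<forall>k. \<exists>n\<ge>k. sim w k (g n) p"
    using \<open>p \<in> A\<close> by blast
qed

section \<open>Saturation under isomorphism and concatenation\<close>

lemma Field_le: "is_word w \<Longrightarrow> Field (le w) = positions w"
  by (auto simp: Field_def intro: is_word_refl dest: is_word_in_positions)

lemma convex_embeddingI:
  assumes "\<And>p. p \<in> positions u \<Longrightarrow> lab w (f p) = lab u p"
    and "\<And>p. p \<in> positions u \<Longrightarrow> left w (f p) = L \<union> f ` left u p"
    and "\<And>p. p \<in> positions u \<Longrightarrow> right w (f p) = R \<union> f ` right u p"
  shows "convex_embedding f u w"
  unfolding convex_embedding_def
  by (intro conjI exI[of _ L] exI[of _ R] ballI) (simp_all add: assms)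

text \<open>The rules of \<open>sigma_rational\<close> admit isomorphic copies, so saturation has to
  follow them. An isomorphism is a convex embedding with nothing outside its image.\<close>

lemma saturated_iso:
  assumes "word_iso u w" "saturated u"
  shows "saturated w"
proof -
  have words: "is_word u" "is_word w" using assms(1) by (auto simp: word_iso_def)
  obtain f where f: "bij_betw f (positions u) (positions w)"
      "\<forall>p\<in>positions u. \<forall>q\<in>positions u. (p, q) \<in> le u \<longleftrightarrow> (f p, f q) \<in> le w"
      "\<forall>p\<in>positions u. lab w (f p) = lab u p"
    using assms(1) unfolding word_iso_def by (elim conjE exE)
  have inj: "inj_on f (positions u)" and img: "positions w = f ` positions u"
    using f(1) by (auto simp: bij_betw_def)
  have sides: "left w (f p) = f ` left u p" "right w (f p) = f ` right u p"
    if p: "p \<in> positions u" for p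
  proof -
    have img_if: "B = f ` A"
      if sub: "A \<subseteq> positions u" "B \<subseteq> positions w"
        and iff: "\<And>q. q \<in> positions u \<Longrightarrow> f q \<in> B \<longleftrightarrow> q \<in> A" for A B
    proof (intro set_eqI iffI)
      fix s assume "s \<in> B"
      then obtain q where "q \<in> positions u" "s = f q" using sub(2) img by auto
      then show "s \<in> f ` A" using iff[of q] \<open>s \<in> B\<close> by simp
    next
      fix s assume "s \<in> f ` A"
      then obtain q where "q \<in> A" "s = f q" by blast
      then show "s \<in> B" using iff[of q] sub(1) by auto
    qed
    have "f q \<in> left w (f p) \<longleftrightarrow> q \<in> left u p" "f q \<in> right w (f p) \<longleftrightarrow> q \<in> right u p"
      if q: "q \<in> positions u" for q
      using f(2)[rule_format, OF p q] f(2)[rule_format, OF q p] inj_on_eq_iff[OF inj q p]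
      unfolding left_def right_def mem_Collect_eq by simp_all
    then show "left w (f p) = f ` left u p" "right w (f p) = f ` right u p"
      by (simp_all add: img_if left_subset right_subset words)
  qed
  have emb: "convex_embedding f u w"
    by (rule convex_embeddingI[where L = "{}" and R = "{}"]) (simp_all add: f(3) sides)
  have cl: "closed_in w (f ` A)" if "closed_in u A" "A \<subseteq> positions u" for A
    using closed_in_embedding[OF emb words(1)] that .
  show ?thesis
    using assms(2) unfolding saturated_def img
    by (simp add: sides cl left_subset[OF words(1)] right_subset[OF words(1)])
qed

text \<open>\<open>Inl\<close> and \<open>Inr\<close> are convex embeddings because the other factor
  lies wholly on one side. Hence each side of a position is the image of a closed set, possibly
  joined with the whole other factor.\<close>

lemma saturated_concat:
  assumes "is_word u" "is_word v" "saturated u" "saturated v"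
  shows "saturated (word_concat u v)" (is "saturated ?w")
proof -
  note Field_le[OF assms(1), simp] Field_le[OF assms(2), simp]
  have L: "left ?w (Inl p) = Inl ` left u p"
    "right ?w (Inl p) = Inr ` positions v \<union> Inl ` right u p" if "p \<in> positions u" for p
    using that by (auto simp: left_def right_def word_concat_def order_sum_def)
  have R: "left ?w (Inr q) = Inl ` positions u \<union> Inr ` left v q"
    "right ?w (Inr q) = Inr ` right v q" if "q \<in> positions v" for q
    using that by (auto simp: left_def right_def word_concat_def order_sum_def)
  have pos: "positions ?w = Inl ` positions u \<union> Inr ` positions v"
    by (auto simp: word_concat_def)
  have "convex_embedding Inl u ?w"
    by (rule convex_embeddingI[where L = "{}" and R = "Inr ` positions v"])
      (auto simp: L, auto simp: word_concat_def)
  note cl = closed_in_embedding[OF this assms(1)]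
  have "convex_embedding Inr v ?w"
    by (rule convex_embeddingI[where L = "Inl ` positions u" and R = "{}"])
      (auto simp: R, auto simp: word_concat_def)
  note cr = closed_in_embedding[OF this assms(2)]
  show ?thesis
    using assms(3,4) unfolding saturated_def pos
    by (auto simp: L R cl cr closed_in_union assms left_subset right_subset)
qed

text \<open>A one-letter labeling turns a bare order into a word, so that \<open>sim\<close>,
  \<open>closed_in\<close> and \<open>saturated\<close> also apply to the exponent of a
  power.\<close>

definition order_word :: "'t rel \<Rightarrow> ('t, unit) word" where
  "order_word r = \<lparr>positions = Field r, le = r, lab = (\<lambda>_. ())\<rparr>"

lemma order_word_simps [simp]:
  "positions (order_word r) = Field r" "lab (order_word r) t = ()"
  by (simp_all add: order_word_def)

lemma order_word_sides:
  "left (order_word r) t \<subseteq> Field r" "right (order_word r) t \<subseteq> Field r"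
  by (auto simp: order_word_def left_def right_def Field_def)

lemma positions_power: "positions (word_power u r) = positions u \<times> Field r"
  by (simp add: word_power_def)

lemma power_sides:
  assumes "is_word u" "p \<in> positions u" "t \<in> Field r"
  shows "left (word_power u r) (p, t) = positions u \<times> left (order_word r) t \<union> left u p \<times> {t}"
    and "right (word_power u r) (p, t) = positions u \<times> right (order_word r) t \<union> right u p \<times> {t}"
proof -
  have "(s, t') \<in> left (word_power u r) (p, t) \<longleftrightarrow>
      (s, t') \<in> positions u \<times> left (order_word r) t \<union> left u p \<times> {t}"
    "(s, t') \<in> right (word_power u r) (p, t) \<longleftrightarrow>
      (s, t') \<in> positions u \<times> right (order_word r) t \<union> right u p \<times> {t}" for s t'
    using assms by (auto simp: left_def right_def word_power_def order_word_def
        intro: FieldI1 FieldI2 dest: is_word_in_positions)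
  then show "left (word_power u r) (p, t) = positions u \<times> left (order_word r) t \<union> left u p \<times> {t}"
    "right (word_power u r) (p, t) = positions u \<times> right (order_word r) t \<union> right u p \<times> {t}"
    by auto
qed

text \<open>Answers combine coordinatewise: a move into another copy keeps the position of u and
  changes the exponent as in \<open>order_word r\<close>; a move inside the current copy is answered
  as in u.\<close>

lemma sim_power:
  assumes u: "is_word u"
  shows "p \<in> positions u \<Longrightarrow> q \<in> positions u \<Longrightarrow> t \<in> Field r \<Longrightarrow> t' \<in> Field r \<Longrightarrow>
    sim u k p q \<Longrightarrow> sim (order_word r) k t t' \<Longrightarrow> sim (word_power u r) k (p, t) (q, t')"
proof (induction k arbitrary: p q t t')
  case 0
  then show ?case by (simp add: word_power_def)
next
  case (Suc k)
  \<comment> \<open>A move inside the copy keeps the exponents, which then only have to agree at the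
    smaller rank.\<close>
  have tt': "sim (order_word r) k t t'" by (rule sim_Suc) fact
  have sides: "rel_set (sim (word_power u r) k)
      (positions u \<times> A \<union> X \<times> {t}) (positions u \<times> B \<union> Y \<times> {t'})"
    if sub: "X \<subseteq> positions u" "Y \<subseteq> positions u" "A \<subseteq> Field r" "B \<subseteq> Field r"
      and rel: "rel_set (sim (order_word r) k) A B" "rel_set (sim u k) X Y" for A B X Y
  proof (rule rel_setI)
    fix s assume "s \<in> positions u \<times> A \<union> X \<times> {t}"
    then consider p1 t1 where "s = (p1, t1)" "p1 \<in> positions u" "t1 \<in> A"
      | p1 where "s = (p1, t)" "p1 \<in> X" by blast
    then show "\<exists>s'\<in>positions u \<times> B \<union> Y \<times> {t'}. sim (word_power u r) k s s'"
    proof cases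
      case 1
      then obtain t2 where "t2 \<in> B" "sim (order_word r) k t1 t2"
        using rel(1) by (blast dest: rel_setD1)
      then show ?thesis
        using 1 sub by (intro bexI[of _ "(p1, t2)"]) (auto intro!: Suc.IH)
    next
      case 2
      then obtain p2 where "p2 \<in> Y" "sim u k p1 p2"
        using rel(2) by (blast dest: rel_setD1)
      then show ?thesis
        using 2 sub tt' Suc.prems by (intro bexI[of _ "(p2, t')"]) (auto intro!: Suc.IH)
    qed
  next
    fix s assume "s \<in> positions u \<times> B \<union> Y \<times> {t'}"
    then consider p1 t1 where "s = (p1, t1)" "p1 \<in> positions u" "t1 \<in> B"
      | p1 where "s = (p1, t')" "p1 \<in> Y" by blast
    then show "\<exists>s'\<in>positions u \<times> A \<union> X \<times> {t}. sim (word_power u r) k s' s"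
    proof cases
      case 1
      then obtain t2 where "t2 \<in> A" "sim (order_word r) k t2 t1"
        using rel(1) by (blast dest: rel_setD2)
      then show ?thesis
        using 1 sub by (intro bexI[of _ "(p1, t2)"]) (auto intro!: Suc.IH)
    next
      case 2
      then obtain p2 where "p2 \<in> X" "sim u k p2 p1"
        using rel(2) by (blast dest: rel_setD2)
      then show ?thesis
        using 2 sub tt' Suc.prems by (intro bexI[of _ "(p2, t)"]) (auto intro!: Suc.IH)
    qed
  qed
  have "lab (word_power u r) (p, t) = lab (word_power u r) (q, t')"
    using Suc.prems by (simp add: word_power_def)
  moreover have "rel_set (sim u k) (left u p) (left u q)" "rel_set (sim u k) (right u p) (right u q)"
    "rel_set (sim (order_word r) k) (left (order_word r) t) (left (order_word r) t')"
    "rel_set (sim (order_word r) k) (right (order_word r) t) (right (order_word r) t')"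
    using Suc.prems by simp_all
  ultimately show ?case
    using Suc.prems
    by (simp only: sim.simps power_sides[OF u] sides left_subset[OF u] right_subset[OF u]
        order_word_sides simp_thms)
qed

text \<open>A cluster point of the exponents comes first, then one of the inner positions along the
  subsequence thus obtained; \<open>sim_power\<close> joins the two.\<close>

lemma closed_in_power:
  assumes u: "is_word u" and A: "closed_in u A" "A \<subseteq> positions u"
    and T: "closed_in (order_word r) T" "T \<subseteq> Field r"
  shows "closed_in (word_power u r) (A \<times> T)"
  unfolding closed_in_def
proof (intro allI impI)
  fix f :: "nat \<Rightarrow> _" assume "range f \<subseteq> A \<times> T"
  then have f: "fst (f n) \<in> A" "snd (f n) \<in> T" for n
    by (auto simp: mem_Times_iff image_subset_iff)
  have "range (snd \<circ> f) \<subseteq> T" using f by auto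
  then obtain z where z: "z \<in> T" "\<forall>k. \<exists>n\<ge>k. sim (order_word r) k (snd (f n)) z"
    using T(1)[unfolded closed_in_def, rule_format, of "snd \<circ> f"] by auto
  \<comment> \<open>The rank of agreement with z grows along h, so every further subsequence still
    converges to z.\<close>
  then obtain h where h: "\<And>k. h k \<ge> k" "\<And>k. sim (order_word r) k (snd (f (h k))) z"
    by metis
  have "range (fst \<circ> f \<circ> h) \<subseteq> A" using f by auto
  then obtain p where p: "p \<in> A" "\<forall>k. \<exists>n\<ge>k. sim u k (fst (f (h n))) p"
    using A(1)[unfolded closed_in_def, rule_format, of "fst \<circ> f \<circ> h"] by auto
  have "\<exists>n\<ge>k. sim (word_power u r) k (f n) (p, z)" for k
  proof -
    obtain n where n: "n \<ge> k" "sim u k (fst (f (h n))) p" using p by blast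
    have "sim (word_power u r) k (fst (f (h n)), snd (f (h n))) (p, z)"
      using n f p z A(2) T(2) by (intro sim_power[OF u] sim_mono[OF n(1) h(2)]) auto
    then show ?thesis using h(1)[of n] n(1) by (intro exI[of _ "h n"]) simp
  qed
  then show "\<exists>p\<in>A \<times> T. \<forall>k. \<exists>n\<ge>k. sim (word_power u r) k (f n) p"
    using p(1) z(1) by blast
qed

lemma saturated_power:
  assumes "is_word u" "saturated u" "saturated (order_word r)"
  shows "saturated (word_power u r)"
  unfolding saturated_def positions_power
proof (intro conjI ballI)
  show "closed_in (word_power u r) (positions u \<times> Field r)"
    using assms unfolding saturated_def by (intro closed_in_power) auto
next
  fix a assume "a \<in> positions u \<times> Field r"
  then obtain p t where a: "a = (p, t)" "p \<in> positions u" "t \<in> Field r" by blast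
  show "closed_in (word_power u r) (left (word_power u r) a)"
    "closed_in (word_power u r) (right (word_power u r) a)"
    using assms a unfolding a(1) power_sides[OF assms(1) a(2,3)] saturated_def
    by (simp_all add: closed_in_union closed_in_power closed_in_finite order_word_sides
        left_subset right_subset)
qed

section \<open>The order type \<open>\<sigma>\<close>\<close>

lemma Field_summands: "Field omega = UNIV" "Field zeta = UNIV" "Field omega_star = {..0}"
  by (auto simp: Field_def omega_def zeta_def omega_star_def)

lemma Field_order_sum: "Field (order_sum r s) = Inl ` Field r \<union> Inr ` Field s"
proof
  show "Field (order_sum r s) \<subseteq> Inl ` Field r \<union> Inr ` Field s"
    by (auto simp: Field_def order_sum_def)
  have "(Inl a, Inl b) \<in> order_sum r s" if "(a, b) \<in> r" for a b
    using that by (simp add: order_sum_def)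
  moreover have "(Inr a, Inr b) \<in> order_sum r s" if "(a, b) \<in> s" for a b
    using that by (simp add: order_sum_def)
  ultimately show "Inl ` Field r \<union> Inr ` Field s \<subseteq> Field (order_sum r s)"
    unfolding Field_def by (fast elim!: DomainE RangeE intro: DomainI RangeI)
qed

lemma order_sum_sides:
  "t \<in> Field r \<Longrightarrow> left (order_word (order_sum r s)) (Inl t) = Inl ` left (order_word r) t"
  "t \<in> Field r \<Longrightarrow> right (order_word (order_sum r s)) (Inl t) =
     Inl ` right (order_word r) t \<union> Inr ` Field s"
  "t' \<in> Field s \<Longrightarrow> left (order_word (order_sum r s)) (Inr t') =
     Inl ` Field r \<union> Inr ` left (order_word s) t'"
  "t' \<in> Field s \<Longrightarrow> right (order_word (order_sum r s)) (Inr t') = Inr ` right (order_word s) t'"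
  by (auto simp: left_def right_def order_word_def order_sum_def)

lemma summand_sides:
  "left (order_word omega) i = {..<i}" "right (order_word omega) i = {i<..}"
  "left (order_word zeta) z = {..<z}" "right (order_word zeta) z = {z<..}"
  "m \<le> 0 \<Longrightarrow> left (order_word omega_star) m = {..<m}"
  "right (order_word omega_star) m = {m<..0}"
  by (auto simp: left_def right_def order_word_def omega_def zeta_def omega_star_def)

lemma Field_sigma: "Field sigma = range Inl \<union> Inr ` (range Inl \<union> Inr ` {..0})"
  by (simp add: sigma_def Field_order_sum Field_summands)

lemma left_sigma:
  "left (order_word sigma) (Inl i) = Inl ` {..<i}"
  "left (order_word sigma) (Inr (Inl z)) = range Inl \<union> Inr ` Inl ` {..<z}"
  "m \<le> 0 \<Longrightarrow> left (order_word sigma) (Inr (Inr m)) =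
     range Inl \<union> Inr ` (range Inl \<union> Inr ` {..<m})"
  by (simp_all add: sigma_def order_sum_sides summand_sides Field_summands Field_order_sum)

lemma right_sigma:
  "right (order_word sigma) (Inl i) = Inl ` {i<..} \<union> Inr ` (range Inl \<union> Inr ` {..0})"
  "right (order_word sigma) (Inr (Inl z)) = Inr ` (Inl ` {z<..} \<union> Inr ` {..0})"
  "m \<le> 0 \<Longrightarrow> right (order_word sigma) (Inr (Inr m)) = Inr ` Inr ` {m<..0}"
  by (simp_all add: sigma_def order_sum_sides summand_sides Field_summands Field_order_sum)

text \<open>On \<open>Field sigma\<close> this means that at least k positions lie on each side; the
  \<zeta>-part qualifies for every k.\<close>

fun middle :: "nat \<Rightarrow> nat + int + int \<Rightarrow> bool" where
  "middle k (Inl i) \<longleftrightarrow> k \<le> i"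
| "middle k (Inr (Inl z)) \<longleftrightarrow> True"
| "middle k (Inr (Inr m)) \<longleftrightarrow> m \<le> - int k"

lemma sigma_cases:
  assumes "t \<in> Field sigma"
  obtains i where "t = Inl i" | z where "t = Inr (Inl z)" | m where "t = Inr (Inr m)" "m \<le> 0"
  using assms unfolding Field_sigma by blast

lemma finite_not_middle: "finite {t \<in> Field sigma. \<not> middle k t}"
proof (rule finite_subset)
  show "{t \<in> Field sigma. \<not> middle k t} \<subseteq> Inl ` {..k} \<union> Inr ` Inr ` {- int k..0}"
    by (auto simp: Field_sigma)
qed auto

lemma middle_side:
  assumes "t' \<in> Field sigma" "middle (Suc k) t'"
  shows "\<exists>s\<in>left (order_word sigma) t'. middle k s" "\<exists>s\<in>right (order_word sigma) t'. middle k s"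
proof -
  show "\<exists>s\<in>left (order_word sigma) t'. middle k s"
    using assms(1)
  proof (cases t' rule: sigma_cases)
    case (1 i)
    then show ?thesis
      \<comment> \<open>\<open>Inl k\<close> is the first position accepted by
        \<open>middle k\<close>, and Suc k \<le> i puts it strictly before
        \<open>Inl i\<close>.\<close>
      using assms by (intro bexI[of _ "Inl k"]) (auto simp: left_sigma)
  next
    case (2 z)
    then show ?thesis
      by (intro bexI[of _ "Inr (Inl (z - 1))"]) (auto simp: left_sigma)
  next
    case (3 m)
    then show ?thesis
      by (intro bexI[of _ "Inr (Inl 0)"]) (auto simp: left_sigma)
  qed
  show "\<exists>s\<in>right (order_word sigma) t'. middle k s"
    using assms(1)
  proof (cases t' rule: sigma_cases)
    case (1 i)
    then show ?thesis
      by (intro bexI[of _ "Inr (Inl 0)"]) (auto simp: right_sigma)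
  next
    case (2 z)
    then show ?thesis
      by (intro bexI[of _ "Inr (Inl (z + 1))"]) (auto simp: right_sigma)
  next
    case (3 m)
    then show ?thesis
      using assms by (intro bexI[of _ "Inr (Inr (- int k))"]) (auto simp: right_sigma)
  qed
qed

text \<open>A position of \<sigma> outside \<open>middle k\<close> is among the first k or the last
  k. The former precede and the latter follow every position in
  \<open>middle (Suc k)\<close>.\<close>

lemma not_middle_side:
  assumes "t \<in> Field sigma" "t' \<in> Field sigma" "middle (Suc k) t" "middle (Suc k) t'" "\<not> middle k s"
  shows "s \<in> left (order_word sigma) t \<Longrightarrow> s \<in> left (order_word sigma) t'"
    and "s \<in> right (order_word sigma) t \<Longrightarrow> s \<in> right (order_word sigma) t'"
proof -
  show "s \<in> left (order_word sigma) t'" if "s \<in> left (order_word sigma) t"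
    using assms that by (elim sigma_cases) (auto simp: left_sigma)
  show "s \<in> right (order_word sigma) t'" if "s \<in> right (order_word sigma) t"
    using assms that by (elim sigma_cases) (auto simp: right_sigma)
qed

text \<open>A move to one of the first or last k positions is answered by the same position, any
  other move by an arbitrary \<open>middle k\<close> position on the required side. One rank is
  spent because \<open>middle (Suc k)\<close> is what guarantees such a position on both
  sides.\<close>

lemma sim_sigma_middle:
  "t \<in> Field sigma \<Longrightarrow> t' \<in> Field sigma \<Longrightarrow> middle k t \<Longrightarrow> middle k t' \<Longrightarrow>
    sim (order_word sigma) k t t'"
proof (induction k arbitrary: t t')
  case (Suc k)
  have l: "\<exists>s'\<in>left (order_word sigma) t'. sim (order_word sigma) k s s'"
    if t: "s \<in> left (order_word sigma) t" "t \<in> Field sigma" "t' \<in> Field sigma"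
      "middle (Suc k) t" "middle (Suc k) t'" for s t t'
  proof (cases "middle k s")
    case True
    obtain s' where s': "s' \<in> left (order_word sigma) t'" "middle k s'"
      using middle_side(1)[OF t(3,5)] by blast
    have "sim (order_word sigma) k s s'"
      using t(1) s' True by (intro Suc.IH) (simp_all add: order_word_sides(1)[THEN subsetD])
    then show ?thesis using s'(1) by blast
  next
    case False
    have "s \<in> left (order_word sigma) t'"
      by (rule not_middle_side(1)[OF t(2-5) False t(1)])
    then show ?thesis by (intro bexI[of _ s] sim_refl)
  qed
  have r: "\<exists>s'\<in>right (order_word sigma) t'. sim (order_word sigma) k s s'"
    if t: "s \<in> right (order_word sigma) t" "t \<in> Field sigma" "t' \<in> Field sigma"
      "middle (Suc k) t" "middle (Suc k) t'" for s t t'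
  proof (cases "middle k s")
    case True
    obtain s' where s': "s' \<in> right (order_word sigma) t'" "middle k s'"
      using middle_side(2)[OF t(3,5)] by blast
    have "sim (order_word sigma) k s s'"
      using t(1) s' True by (intro Suc.IH) (simp_all add: order_word_sides(2)[THEN subsetD])
    then show ?thesis using s'(1) by blast
  next
    case False
    have "s \<in> right (order_word sigma) t'"
      by (rule not_middle_side(2)[OF t(2-5) False t(1)])
    then show ?thesis by (intro bexI[of _ s] sim_refl)
  qed
  have "rel_set (sim (order_word sigma) k) (left (order_word sigma) t) (left (order_word sigma) t')"
    using l[OF _ Suc.prems] l[OF _ Suc.prems(2,1,4,3)] sim_sym[of "order_word sigma" k]
    by (intro rel_setI) fast+
  moreover have "rel_set (sim (order_word sigma) k) (right (order_word sigma) t) (right (order_word sigma) t')"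
    using r[OF _ Suc.prems] r[OF _ Suc.prems(2,1,4,3)] sim_sym[of "order_word sigma" k]
    by (intro rel_setI) fast+
  ultimately show ?case by simp
qed simp

text \<open>A sequence that leaves every finite set converges to every position of the \<open>\<zeta>\<close>-part.\<close>

lemma closed_in_sigma:
  assumes "T \<subseteq> Field sigma" "Inr (Inl z) \<in> T"
  shows "closed_in (order_word sigma) T"
  unfolding closed_in_def
proof (intro allI impI)
  fix f :: "nat \<Rightarrow> _" assume f: "range f \<subseteq> T"
  show "\<exists>p\<in>T. \<forall>k. \<exists>n\<ge>k. sim (order_word sigma) k (f n) p"
  proof (cases "\<exists>k. infinite {n. f n \<in> {t \<in> T. \<not> middle k t}}")
    case True
    then obtain k where k: "infinite {n. f n \<in> {t \<in> T. \<not> middle k t}}" by blast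
    have "finite {t \<in> T. \<not> middle k t}"
      by (rule finite_subset[OF _ finite_not_middle[of k]]) (use assms in auto)
    from closed_in_subsequence[OF closed_in_finite[OF this] k] show ?thesis by blast
  next
    case False
    have "\<exists>n\<ge>k. sim (order_word sigma) k (f n) (Inr (Inl z))" for k
    proof -
      obtain N where N: "\<forall>n\<in>{n. f n \<in> {t \<in> T. \<not> middle k t}}. n < N"
        using False finite_nat_set_iff_bounded by blast
      have "middle k (f (max k N))"
        using N f by (force simp: not_less)
      then have "sim (order_word sigma) k (f (max k N)) (Inr (Inl z))"
        using f assms by (intro sim_sigma_middle) auto
      then show ?thesis by (intro exI[of _ "max k N"]) simp
    qed
    then show ?thesis using assms(2) by blast
  qed
qed

text \<open>A side of a position either contains a \<zeta>-position, so that
  \<open>closed_in_sigma\<close> applies, or is finite: only the left of an \<omega>-position and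
  the right of an \<open>\<omega>\<^sup>*\<close>-position miss the \<zeta>-part.\<close>

lemma saturated_sigma: "saturated (order_word sigma)"
  unfolding saturated_def order_word_simps
proof (intro conjI ballI)
  show "closed_in (order_word sigma) (Field sigma)"
    by (rule closed_in_sigma[of _ 0]) (auto simp: Field_sigma)
next
  fix t assume t: "t \<in> Field sigma"
  show "closed_in (order_word sigma) (left (order_word sigma) t)"
  proof (cases "\<exists>z. Inr (Inl z) \<in> left (order_word sigma) t")
    case True
    then show ?thesis by (elim exE) (rule closed_in_sigma[OF order_word_sides(1)])
  next
    case False
    then have no: "Inr (Inl z) \<notin> left (order_word sigma) t" for z by blast
    from t have "finite (left (order_word sigma) t)"
    proof (cases t rule: sigma_cases)
      case (1 i)
      then show ?thesis using no[of 0] by (simp add: left_sigma)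
    next
      case (2 z)
      then show ?thesis using no[of "z - 1"] by (simp add: left_sigma)
    next
      case (3 m)
      then show ?thesis using no[of 0] by (simp add: left_sigma)
    qed
    then show ?thesis by (rule closed_in_finite)
  qed
  show "closed_in (order_word sigma) (right (order_word sigma) t)"
  proof (cases "\<exists>z. Inr (Inl z) \<in> right (order_word sigma) t")
    case True
    then show ?thesis by (elim exE) (rule closed_in_sigma[OF order_word_sides(2)])
  next
    case False
    then have no: "Inr (Inl z) \<notin> right (order_word sigma) t" for z by blast
    from t have "finite (right (order_word sigma) t)"
    proof (cases t rule: sigma_cases)
      case (1 i)
      then show ?thesis using no[of 0] by (simp add: right_sigma)
    next
      case (2 z)
      then show ?thesis using no[of "z + 1"] by (simp add: right_sigma)
    next
      case (3 m)
      then show ?thesis using no[of 0] by (simp add: right_sigma)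
    qed
    then show ?thesis by (rule closed_in_finite)
  qed
qed

section \<open>Every \<sigma>-rational word is tame\<close>

lemma word_iso_labels:
  assumes "word_iso u w"
  shows "lab w ` positions w = lab u ` positions u"
proof -
  obtain f where "bij_betw f (positions u) (positions w)" "\<forall>p\<in>positions u. lab w (f p) = lab u p"
    using assms unfolding word_iso_def by (elim conjE exE)
  then have f: "positions w = f ` positions u" "\<forall>p\<in>positions u. lab w (f p) = lab u p"
    by (simp_all add: bij_betw_def)
  show ?thesis
    unfolding f(1) image_image by (rule image_cong) (use f(2) in auto)
qed

text \<open>The alphabet may be infinite, but a \<sigma>-rational word uses only finitely many
  letters. This is what makes \<open>sim\<close> of finite index, already at rank 0.\<close>

definition tame :: "('p, 'a) word \<Rightarrow> bool" where
  "tame w \<longleftrightarrow> is_word w \<and> saturated w \<and> finite (lab w ` positions w)"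

lemma tame_iso:
  assumes "word_iso u w" "saturated u" "finite (lab u ` positions u)"
  shows "tame w"
  unfolding tame_def word_iso_labels[OF assms(1)]
  using assms saturated_iso[OF assms(1,2)] by (simp add: word_iso_def)

lemma sigma_rational_tame: "sigma_rational w \<Longrightarrow> tame w"
proof (induction rule: sigma_rational.induct)
  case (finite as w)
  have word: "is_word (finite_word as)" using finite by (simp add: word_iso_def)
  have fin: "finite (positions (finite_word as))" by (simp add: finite_word_def)
  have "saturated (finite_word as)"
    unfolding saturated_def
    by (simp add: closed_in_finite fin finite_subset[OF left_subset[OF word] fin]
        finite_subset[OF right_subset[OF word] fin])
  then show ?case
    by (rule tame_iso[OF finite]) (use fin in simp)
next
  case (concat u v w)
  have "lab (word_concat u v) ` positions (word_concat u v) =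
      lab u ` positions u \<union> lab v ` positions v"
    by (simp add: word_concat_def Plus_def image_Un image_image)
  then show ?case
    using concat.IH saturated_concat[of u v]
    by (intro tame_iso[OF concat.hyps(3)]) (simp_all add: tame_def)
next
  case (power u w)
  have "lab (word_power u sigma) ` positions (word_power u sigma) \<subseteq> lab u ` positions u"
    by (auto simp: word_power_def)
  then show ?case
    using power.IH saturated_power[OF _ _ saturated_sigma, of u]
    by (intro tame_iso[OF power.hyps(2)]) (auto simp: tame_def dest: finite_subset)
qed

section \<open>Two-variable formulas on saturated words\<close>

primrec qd :: "'a fm \<Rightarrow> nat" where
  "qd Top = 0"
| "qd Bot = 0"
| "qd (Eq x y) = 0"
| "qd (Lab x a) = 0"
| "qd (Less x y) = 0"
| "qd (LessEq x y) = 0"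
| "qd (Neg \<phi>) = qd \<phi>"
| "qd (Disj \<phi> \<psi>) = max (qd \<phi>) (qd \<psi>)"
| "qd (Conj \<phi> \<psi>) = max (qd \<phi>) (qd \<psi>)"
| "qd (Ex x \<phi>) = Suc (qd \<phi>)"
| "qd (All x \<phi>) = Suc (qd \<phi>)"

section \<open>Back-and-forth for two-variable formulas\<close>

lemma FV_subset_vars: "FV \<phi> \<subseteq> vars \<phi>"
  by (induction \<phi>) auto

text \<open>V is kept apart from the domains of \<alpha> and \<beta> because requantifying a
  variable forgets its old value: only the variables that are still free are compared.\<close>

definition match :: "('p, 'a) word \<Rightarrow> nat \<Rightarrow> var set \<Rightarrow> (var \<rightharpoonup> 'p) \<Rightarrow> (var \<rightharpoonup> 'p) \<Rightarrow> bool" where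
  "match w k V \<alpha> \<beta> \<longleftrightarrow>
     (\<forall>z\<in>V. the (\<alpha> z) \<in> positions w \<and> the (\<beta> z) \<in> positions w \<and> sim w k (the (\<alpha> z)) (the (\<beta> z))) \<and>
     (\<forall>z\<in>V. \<forall>z'\<in>V. ((the (\<alpha> z), the (\<alpha> z')) \<in> le w \<longleftrightarrow> (the (\<beta> z), the (\<beta> z')) \<in> le w) \<and>
        (the (\<alpha> z) = the (\<alpha> z') \<longleftrightarrow> the (\<beta> z) = the (\<beta> z')))"

lemma match_subset: "match w k V \<alpha> \<beta> \<Longrightarrow> U \<subseteq> V \<Longrightarrow> match w k U \<alpha> \<beta>"
  unfolding match_def by (meson subsetD)

lemma match_sym: "match w k V \<alpha> \<beta> \<Longrightarrow> match w k V \<beta> \<alpha>"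
  unfolding match_def by (simp add: sim_sym)

lemma match_single:
  assumes "is_word w" "p \<in> positions w" "q \<in> positions w" "sim w k p q"
  shows "match w k {z} (\<alpha>(z \<mapsto> p)) (\<beta>(z \<mapsto> q))"
  using assms is_word_refl[of w] by (simp add: match_def)

lemma match_pair:
  assumes w: "is_word w" and z: "z \<noteq> y" and pos: "p \<in> positions w" "q \<in> positions w"
    and y: "the (\<alpha> y) \<in> positions w" "the (\<beta> y) \<in> positions w"
    and sim: "sim w k (the (\<alpha> y)) (the (\<beta> y))" "sim w k p q"
    and l: "p \<in> left w (the (\<alpha> y)) \<longleftrightarrow> q \<in> left w (the (\<beta> y))"
    and r: "p \<in> right w (the (\<alpha> y)) \<longleftrightarrow> q \<in> right w (the (\<beta> y))"
  shows "match w k {z, y} (\<alpha>(z \<mapsto> p)) (\<beta>(z \<mapsto> q))"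
proof -
  have split: "p = a \<or> p \<in> left w a \<or> p \<in> right w a"
    "p \<in> left w a \<Longrightarrow> (p, a) \<in> le w \<and> (a, p) \<notin> le w \<and> p \<noteq> a"
    "p \<in> right w a \<Longrightarrow> (a, p) \<in> le w \<and> (p, a) \<notin> le w \<and> p \<noteq> a"
    if "p \<in> positions w" "a \<in> positions w" for p a
    using positions_split[OF w that(2)] that is_word_antisym[OF w, of p a]
    by (auto simp: left_def right_def)
  have "(p, the (\<alpha> y)) \<in> le w \<longleftrightarrow> (q, the (\<beta> y)) \<in> le w"
    "(the (\<alpha> y), p) \<in> le w \<longleftrightarrow> (the (\<beta> y), q) \<in> le w"
    "p = the (\<alpha> y) \<longleftrightarrow> q = the (\<beta> y)"
    using split[OF pos(1) y(1)] split[OF pos(2) y(2)] l r is_word_refl[OF w y(1)] is_word_refl[OF w y(2)]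
    by metis+
  then show ?thesis
    using assms is_word_refl[OF w] by (auto simp: match_def)
qed

text \<open>Here the restriction to two variables pays off. With one other pebble, at y,
  \<open>sim\<close> supplies an answer on the correct side at the cost of one rank; with two other
  pebbles, an answer between them could not be had from their sides separately.\<close>

lemma match_extend:
  assumes w: "is_word w" and m: "match w (Suc k) V \<alpha> \<beta>" and V: "V \<subseteq> {y}" "z \<notin> V"
    and p: "p \<in> positions w"
  shows "\<exists>q\<in>positions w. match w k (insert z V) (\<alpha>(z \<mapsto> p)) (\<beta>(z \<mapsto> q))"
proof (cases "y \<in> V")
  case False
  then have "V = {}" using V by auto
  then show ?thesis
    using match_single[OF w p p sim_refl] p by (intro bexI[of _ p]) simp_all
next
  case True
  then have V: "V = {y}" and zy: "z \<noteq> y" using V by auto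
  let ?a = "the (\<alpha> y)" and ?b = "the (\<beta> y)"
  have pos: "?a \<in> positions w" "?b \<in> positions w" and sim: "sim w (Suc k) ?a ?b"
    using m V by (auto simp: match_def simp del: sim.simps)
  note sim' = sim_Suc[OF sim]
  have disj: "c \<notin> left w c" "c \<notin> right w c" "left w c \<inter> right w c = {}" for c
    using is_word_antisym[OF w] by (auto simp: left_def right_def)
  consider "p \<in> left w ?a" | "p = ?a" | "p \<in> right w ?a"
    using p positions_split[OF w pos(1)] by blast
  then obtain q where q: "q \<in> positions w" "sim w k p q"
    "p \<in> left w ?a \<longleftrightarrow> q \<in> left w ?b" "p \<in> right w ?a \<longleftrightarrow> q \<in> right w ?b"
  proof cases
    case 1
    then obtain q where "q \<in> left w ?b" "sim w k p q"
      using sim by (auto dest: rel_setD1)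
    then show ?thesis
      using that[of q] 1 disj left_subset[OF w] by blast
  next
    case 2
    then show ?thesis
      using that[of ?b] disj pos sim' by simp
  next
    case 3
    then obtain q where "q \<in> right w ?b" "sim w k p q"
      using sim by (auto dest: rel_setD1)
    then show ?thesis
      using that[of q] 3 disj right_subset[OF w] by blast
  qed
  show ?thesis
    unfolding V using match_pair[of w z y p q \<alpha> \<beta>, OF w zy p q(1) pos sim' q(2-4)] q(1)
    by (rule bexI)
qed

lemma FV_quantified:
  assumes "vars \<phi> \<subseteq> {x, y}" "z \<in> {x, y}"
  shows "\<exists>t. FV \<phi> - {z} \<subseteq> {t}"
  using assms FV_subset_vars[of \<phi>] by auto

lemma match_sat:
  assumes w: "is_word w"
  shows "vars \<phi> \<subseteq> {x, y} \<Longrightarrow> qd \<phi> \<le> k \<Longrightarrow> match w k (FV \<phi>) \<alpha> \<beta> \<Longrightarrow>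
    sat w \<alpha> \<phi> \<longleftrightarrow> sat w \<beta> \<phi>"
proof (induction \<phi> arbitrary: k \<alpha> \<beta>)
  case (Lab z a)
  then show ?case by (auto simp: match_def dest: sim_lab)
next
  case (Disj \<phi> \<psi>)
  then have "match w k (FV \<phi>) \<alpha> \<beta>" "match w k (FV \<psi>) \<alpha> \<beta>"
    by (auto elim: match_subset)
  then show ?case using Disj.IH[of k \<alpha> \<beta>] Disj.prems by simp
next
  case (Conj \<phi> \<psi>)
  then have "match w k (FV \<phi>) \<alpha> \<beta>" "match w k (FV \<psi>) \<alpha> \<beta>"
    by (auto elim: match_subset)
  then show ?case using Conj.IH[of k \<alpha> \<beta>] Conj.prems by simp
next
  case (Ex z \<phi>)
  then obtain j where k: "k = Suc j" "qd \<phi> \<le> j" by (cases k) auto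
  have vars: "vars \<phi> \<subseteq> {x, y}" "z \<in> {x, y}" using Ex.prems by auto
  obtain t where t: "FV \<phi> - {z} \<subseteq> {t}" using FV_quantified[OF vars] by blast
  \<comment> \<open>Both valuations are arbitrary here, so that exchanging them through
    \<open>match_sym\<close> gives the converse direction.\<close>
  have step: "\<exists>q\<in>positions w. sat w (\<beta>(z \<mapsto> q)) \<phi>"
    if m: "match w k (FV \<phi> - {z}) \<alpha> \<beta>" and p: "p \<in> positions w" "sat w (\<alpha>(z \<mapsto> p)) \<phi>" for \<alpha> \<beta> p
  proof -
    obtain q where q: "q \<in> positions w" "match w j (insert z (FV \<phi> - {z})) (\<alpha>(z \<mapsto> p)) (\<beta>(z \<mapsto> q))"
      using match_extend[OF w m[unfolded k(1)] t _ p(1)] by blast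
    then have "match w j (FV \<phi>) (\<alpha>(z \<mapsto> p)) (\<beta>(z \<mapsto> q))"
      by (auto elim: match_subset)
    then show ?thesis using Ex.IH[OF vars(1) k(2)] p q by blast
  qed
  show ?case
    using step[of \<alpha> \<beta>] step[of \<beta> \<alpha>] Ex.prems(3) match_sym[OF Ex.prems(3)] by auto
next
  case (All z \<phi>)
  then obtain j where k: "k = Suc j" "qd \<phi> \<le> j" by (cases k) auto
  have vars: "vars \<phi> \<subseteq> {x, y}" "z \<in> {x, y}" using All.prems by auto
  obtain t where t: "FV \<phi> - {z} \<subseteq> {t}" using FV_quantified[OF vars] by blast
  have step: "\<exists>q\<in>positions w. \<not> sat w (\<beta>(z \<mapsto> q)) \<phi>"
    if m: "match w k (FV \<phi> - {z}) \<alpha> \<beta>" and p: "p \<in> positions w" "\<not> sat w (\<alpha>(z \<mapsto> p)) \<phi>" for \<alpha> \<beta> p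
  proof -
    obtain q where q: "q \<in> positions w" "match w j (insert z (FV \<phi> - {z})) (\<alpha>(z \<mapsto> p)) (\<beta>(z \<mapsto> q))"
      using match_extend[OF w m[unfolded k(1)] t _ p(1)] by blast
    then have "match w j (FV \<phi>) (\<alpha>(z \<mapsto> p)) (\<beta>(z \<mapsto> q))"
      by (auto elim: match_subset)
    then show ?thesis using All.IH[OF vars(1) k(2)] p q by blast
  qed
  show ?case
    using step[of \<alpha> \<beta>] step[of \<beta> \<alpha>] All.prems(3) match_sym[OF All.prems(3)] by auto
qed (auto simp: match_def)

text \<open>Suppose no finite subset works. At a fixed rank k there are finitely many classes, and
  one failing formula per class would be such a subset; hence some \<open>f k\<close> in A satisfies
  all formulas of rank at most k. A cluster point of f then satisfies all of \<Phi>.\<close>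

lemma closed_in_compact:
  assumes w: "is_word w" "finite (lab w ` positions w)"
    and A: "closed_in w A" "A \<subseteq> positions w"
    and S: "\<And>\<phi> k p q. \<phi> \<in> \<Phi> \<Longrightarrow> rank \<phi> \<le> k \<Longrightarrow> p \<in> A \<Longrightarrow> q \<in> A \<Longrightarrow> sim w k p q \<Longrightarrow> S p \<phi> \<Longrightarrow> S q \<phi>"
    and "\<forall>p\<in>A. \<exists>\<phi>\<in>\<Phi>. \<not> S p \<phi>"
  shows "\<exists>\<Psi>\<subseteq>\<Phi>. finite \<Psi> \<and> (\<forall>p\<in>A. \<exists>\<phi>\<in>\<Psi>. \<not> S p \<phi>)"
proof (rule ccontr)
  assume no: "\<not> ?thesis"
  have "\<exists>p\<in>A. \<forall>\<phi>\<in>\<Phi>. rank \<phi> \<le> k \<longrightarrow> S p \<phi>" for k :: nat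
  proof (rule ccontr)
    assume "\<not> ?thesis"
    then have "\<forall>p\<in>A. \<exists>\<phi>. \<phi> \<in> \<Phi> \<and> rank \<phi> \<le> k \<and> \<not> S p \<phi>" by blast
    then obtain g where g: "\<And>p. p \<in> A \<Longrightarrow> g p \<in> \<Phi> \<and> rank (g p) \<le> k \<and> \<not> S p (g p)" by metis
    obtain D where D: "finite D" "\<forall>p\<in>positions w. \<exists>d\<in>D. sim w k p d"
      using sim_finite_index[OF w(2,1)] by blast
    \<comment> \<open>Representatives in D may lie outside A, where S need not transfer. Grouping A
      by the chosen representative yields a finite set E of representatives inside A.\<close>
    define c where "c p = (SOME d. d \<in> D \<and> sim w k p d)" for p
    have c: "c p \<in> D" "sim w k p (c p)" if "p \<in> A" for p
      using someI_ex[of "\<lambda>d. d \<in> D \<and> sim w k p d"] D(2) A(2) that unfolding c_def by blast+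
    have "finite (c ` A)" by (rule finite_subset[OF _ D(1)]) (use c in blast)
    moreover have "sim w k p q" if "p \<in> A" "q \<in> A" "c p = c q" for p q
      using c[OF that(1)] c[OF that(2)] that(3) sim_trans sim_sym by metis
    ultimately obtain E where E: "finite E" "E \<subseteq> A" "\<forall>p\<in>A. \<exists>d\<in>E. sim w k p d"
      using finite_representatives[of c A "sim w k"] by blast
    have "\<exists>\<phi>\<in>g ` E. \<not> S p \<phi>" if p: "p \<in> A" for p
    proof -
      obtain d where d: "d \<in> E" "sim w k p d" using E(3) p by blast
      then have "d \<in> A" using E(2) by blast
      then have "\<not> S p (g d)" using S[OF _ _ p _ d(2)] g by blast
      then show ?thesis using d(1) by blast
    qed
    moreover have "g ` E \<subseteq> \<Phi>" using g E(2) by blast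
    ultimately show False using no E(1) by blast
  qed
  then obtain f where f: "\<And>k. f k \<in> A" "\<And>k \<phi>. \<phi> \<in> \<Phi> \<Longrightarrow> rank \<phi> \<le> k \<Longrightarrow> S (f k) \<phi>"
    by metis
  then have "range f \<subseteq> A" by blast
  then obtain p where p: "p \<in> A" "\<forall>k. \<exists>n\<ge>k. sim w k (f n) p"
    using A(1)[unfolded closed_in_def, rule_format, of f] by blast
  obtain \<phi> where \<phi>: "\<phi> \<in> \<Phi>" "\<not> S p \<phi>" using assms(6) p(1) by blast
  \<comment> \<open>An index at least rank \<phi> makes \<open>f n\<close> satisfy \<phi>, and
    agreement at that rank carries \<phi> over to p.\<close>
  obtain n where n: "n \<ge> rank \<phi>" "sim w (rank \<phi>) (f n) p" using p(2) by blast
  have "S p \<phi>" by (rule S[OF \<phi>(1) order_refl f(1) p(1) n(2) f(2)[OF \<phi>(1) n(1)]])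
  then show False using \<phi>(2) by blast
qed

text \<open>If the other variable t is assigned, its order relation to z is constant on each side of
  its position. Both sides are handled by \<open>closed_in_compact\<close>, and the position itself
  costs one more formula.\<close>

lemma FO2_compact:
  assumes w: "tame w" and vars: "\<And>\<phi>. \<phi> \<in> \<Phi> \<Longrightarrow> vars \<phi> \<subseteq> {x, y}"
    and z: "z \<in> {x, y}" and FV: "\<And>\<phi>. \<phi> \<in> \<Phi> \<Longrightarrow> FV \<phi> \<subseteq> insert z (dom \<alpha>)"
    and ran: "ran \<alpha> \<subseteq> positions w"
    and no: "\<forall>p\<in>positions w. \<exists>\<phi>\<in>\<Phi>. \<not> sat w (\<alpha>(z \<mapsto> p)) \<phi>"
  shows "\<exists>\<Psi>\<subseteq>\<Phi>. finite \<Psi> \<and> (\<forall>p\<in>positions w. \<exists>\<phi>\<in>\<Psi>. \<not> sat w (\<alpha>(z \<mapsto> p)) \<phi>)"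
proof -
  have word: "is_word w" and lab: "finite (lab w ` positions w)" and sat: "saturated w"
    using w by (auto simp: tame_def)
  obtain t where t: "{x, y} = {z, t}" using z by blast
  have piece: "\<exists>\<Psi>\<subseteq>\<Phi>. finite \<Psi> \<and> (\<forall>p\<in>A. \<exists>\<phi>\<in>\<Psi>. \<not> sat w (\<alpha>(z \<mapsto> p)) \<phi>)"
    if A: "closed_in w A" "A \<subseteq> positions w"
      and m: "\<And>k p q. p \<in> A \<Longrightarrow> q \<in> A \<Longrightarrow> sim w k p q \<Longrightarrow>
        match w k ({x, y} \<inter> insert z (dom \<alpha>)) (\<alpha>(z \<mapsto> p)) (\<alpha>(z \<mapsto> q))" for A
  proof (rule closed_in_compact[OF word lab A, where rank = qd])
    show "\<forall>p\<in>A. \<exists>\<phi>\<in>\<Phi>. \<not> sat w (\<alpha>(z \<mapsto> p)) \<phi>" using no A(2) by blast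
  next
    fix \<phi> k p q
    assume "\<phi> \<in> \<Phi>" "qd \<phi> \<le> k" "p \<in> A" "q \<in> A" "sim w k p q" "sat w (\<alpha>(z \<mapsto> p)) \<phi>"
    moreover from this have "match w k (FV \<phi>) (\<alpha>(z \<mapsto> p)) (\<alpha>(z \<mapsto> q))"
      using vars[of \<phi>] FV[of \<phi>] FV_subset_vars[of \<phi>] by (intro match_subset[OF m]) auto
    ultimately show "sat w (\<alpha>(z \<mapsto> q)) \<phi>"
      using match_sat[OF word vars] by blast
  qed
  show ?thesis
  \<comment> \<open>x and y may coincide here; then t is z, and its old value is
    overwritten.\<close>
  proof (cases "t \<in> dom \<alpha> \<and> t \<noteq> z")
    case False
    then have "{x, y} \<inter> insert z (dom \<alpha>) = {z}" using t by auto
    then show ?thesis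
      using sat match_single[OF word] unfolding saturated_def by (intro piece) auto
  next
    case True
    then have V: "{x, y} \<inter> insert z (dom \<alpha>) = {z, t}" and zt: "z \<noteq> t" using t by auto
    have pos: "the (\<alpha> t) \<in> positions w" using True ran by (auto simp: ran_def)
    let ?L = "left w (the (\<alpha> t))" and ?R = "right w (the (\<alpha> t))"
    have disj: "the (\<alpha> t) \<notin> ?L" "the (\<alpha> t) \<notin> ?R" "?L \<inter> ?R = {}"
      using is_word_antisym[OF word] by (auto simp: left_def right_def)
    have m: "match w k {z, t} (\<alpha>(z \<mapsto> p)) (\<alpha>(z \<mapsto> q))"
      if "p \<in> positions w" "q \<in> positions w" "sim w k p q" "p \<in> ?L \<longleftrightarrow> q \<in> ?L" "p \<in> ?R \<longleftrightarrow> q \<in> ?R" for k p q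
      by (rule match_pair[of w z t p q \<alpha> \<alpha>, OF word zt that(1,2) pos pos sim_refl that(3-5)])
    have "\<exists>\<Psi>\<subseteq>\<Phi>. finite \<Psi> \<and> (\<forall>p\<in>?L. \<exists>\<phi>\<in>\<Psi>. \<not> sat w (\<alpha>(z \<mapsto> p)) \<phi>)"
    proof (rule piece)
      show "closed_in w ?L" using sat pos by (simp add: saturated_def)
      show sub: "?L \<subseteq> positions w" by (rule left_subset[OF word])
      fix k p q assume "p \<in> ?L" "q \<in> ?L" "sim w k p q"
      then show "match w k ({x, y} \<inter> insert z (dom \<alpha>)) (\<alpha>(z \<mapsto> p)) (\<alpha>(z \<mapsto> q))"
        unfolding V using sub disj by (intro m) auto
    qed
    then obtain \<Psi>1 where 1: "\<Psi>1 \<subseteq> \<Phi>" "finite \<Psi>1" "\<forall>p\<in>?L. \<exists>\<phi>\<in>\<Psi>1. \<not> sat w (\<alpha>(z \<mapsto> p)) \<phi>"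
      by (elim exE conjE)
    have "\<exists>\<Psi>\<subseteq>\<Phi>. finite \<Psi> \<and> (\<forall>p\<in>?R. \<exists>\<phi>\<in>\<Psi>. \<not> sat w (\<alpha>(z \<mapsto> p)) \<phi>)"
    proof (rule piece)
      show "closed_in w ?R" using sat pos by (simp add: saturated_def)
      show sub: "?R \<subseteq> positions w" by (rule right_subset[OF word])
      fix k p q assume "p \<in> ?R" "q \<in> ?R" "sim w k p q"
      then show "match w k ({x, y} \<inter> insert z (dom \<alpha>)) (\<alpha>(z \<mapsto> p)) (\<alpha>(z \<mapsto> q))"
        unfolding V using sub disj by (intro m) auto
    qed
    then obtain \<Psi>2 where 2: "\<Psi>2 \<subseteq> \<Phi>" "finite \<Psi>2" "\<forall>p\<in>?R. \<exists>\<phi>\<in>\<Psi>2. \<not> sat w (\<alpha>(z \<mapsto> p)) \<phi>"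
      by (elim exE conjE)
    obtain \<psi> where 3: "\<psi> \<in> \<Phi>" "\<not> sat w (\<alpha>(z \<mapsto> the (\<alpha> t))) \<psi>"
      using no pos by blast
    have "\<forall>p\<in>positions w. \<exists>\<phi>\<in>insert \<psi> (\<Psi>1 \<union> \<Psi>2). \<not> sat w (\<alpha>(z \<mapsto> p)) \<phi>"
      unfolding positions_split[OF word pos] using 1(3) 2(3) 3(2) by blast
    then show ?thesis
      using 1(1,2) 2(1,2) 3(1) by (intro exI[of _ "insert \<psi> (\<Psi>1 \<union> \<Psi>2)"]) auto
  qed
qed

section \<open>Fragments and their reducts\<close>

lemma fragmentD:
  assumes "fragment X F"
  shows "fill \<mu> \<phi> \<in> F \<Longrightarrow> fill \<mu> Top \<in> F" "fill \<mu> \<phi> \<in> F \<Longrightarrow> fill \<mu> Bot \<in> F"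
    "fill \<mu> \<phi> \<in> F \<Longrightarrow> z \<in> X \<Longrightarrow> fill \<mu> (Lab z a) \<in> F"
    "fill \<mu> (Disj \<phi> \<psi>) \<in> F \<longleftrightarrow> fill \<mu> \<phi> \<in> F \<and> fill \<mu> \<psi> \<in> F"
    "fill \<mu> (Conj \<phi> \<psi>) \<in> F \<longleftrightarrow> fill \<mu> \<phi> \<in> F \<and> fill \<mu> \<psi> \<in> F"
    "fill \<mu> (Neg (Neg \<phi>)) \<in> F \<Longrightarrow> fill \<mu> \<phi> \<in> F"
    "fill \<mu> (Ex z \<phi>) \<in> F \<Longrightarrow> z \<notin> FV \<phi> \<Longrightarrow> fill \<mu> \<phi> \<in> F"
    "fill \<mu> (All z \<phi>) \<in> F \<Longrightarrow> z \<notin> FV \<phi> \<Longrightarrow> fill \<mu> \<phi> \<in> F"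
    "fill \<mu> (Less z z') \<in> F \<longleftrightarrow> fill \<mu> (LessEq z z') \<in> F"
proof -
  note D = assms[unfolded fragment_def, THEN conjunct2]
  note atoms = D[THEN conjunct1, rule_format] and D = D[THEN conjunct2]
  show "fill \<mu> \<phi> \<in> F \<Longrightarrow> fill \<mu> Top \<in> F" "fill \<mu> \<phi> \<in> F \<Longrightarrow> fill \<mu> Bot \<in> F"
    "fill \<mu> \<phi> \<in> F \<Longrightarrow> z \<in> X \<Longrightarrow> fill \<mu> (Lab z a) \<in> F"
    using atoms[of \<mu> \<phi>] by simp_all
  show "fill \<mu> (Disj \<phi> \<psi>) \<in> F \<longleftrightarrow> fill \<mu> \<phi> \<in> F \<and> fill \<mu> \<psi> \<in> F"
    by (rule D[THEN conjunct1, rule_format])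
  note D = D[THEN conjunct2]
  show "fill \<mu> (Conj \<phi> \<psi>) \<in> F \<longleftrightarrow> fill \<mu> \<phi> \<in> F \<and> fill \<mu> \<psi> \<in> F"
    by (rule D[THEN conjunct1, rule_format])
  note D = D[THEN conjunct2]
  show "fill \<mu> (Neg (Neg \<phi>)) \<in> F \<Longrightarrow> fill \<mu> \<phi> \<in> F"
    by (rule D[THEN conjunct1, rule_format])
  note D = D[THEN conjunct2]
  show "fill \<mu> (Ex z \<phi>) \<in> F \<Longrightarrow> z \<notin> FV \<phi> \<Longrightarrow> fill \<mu> \<phi> \<in> F"
    using D[THEN conjunct1, rule_format, of \<mu> z \<phi>] by simp
  note D = D[THEN conjunct2]
  show "fill \<mu> (All z \<phi>) \<in> F \<Longrightarrow> z \<notin> FV \<phi> \<Longrightarrow> fill \<mu> \<phi> \<in> F"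
    using D[THEN conjunct1, rule_format, of \<mu> z \<phi>] by simp
  show "fill \<mu> (Less z z') \<in> F \<longleftrightarrow> fill \<mu> (LessEq z z') \<in> F"
    by (rule D[THEN conjunct2, rule_format])
qed

lemma fragment_Top: "fragment X F \<Longrightarrow> Top \<in> F"
  and fragment_Bot: "fragment X F \<Longrightarrow> Bot \<in> F"
proof -
  assume F: "fragment X F"
  obtain \<phi> where "\<phi> \<in> F" using F[unfolded fragment_def, THEN conjunct1] by blast
  then show "Top \<in> F" "Bot \<in> F"
    using fragmentD(1,2)[OF F, of Hole] by simp_all
qed

lemma fragment_Conj: "fragment X F \<Longrightarrow> Conj \<phi> \<psi> \<in> F \<longleftrightarrow> \<phi> \<in> F \<and> \<psi> \<in> F"
  using fragmentD(5)[of X F Hole] by simp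

lemma fragment_Disj: "fragment X F \<Longrightarrow> Disj \<phi> \<psi> \<in> F \<longleftrightarrow> \<phi> \<in> F \<and> \<psi> \<in> F"
  using fragmentD(4)[of X F Hole] by simp

lemma fragment_Neg_Conj: "fragment X F \<Longrightarrow> Neg (Conj \<phi> \<psi>) \<in> F \<longleftrightarrow> Neg \<phi> \<in> F \<and> Neg \<psi> \<in> F"
  using fragmentD(5)[of X F "CNeg Hole"] by simp

lemma fragment_Neg_Disj: "fragment X F \<Longrightarrow> Neg (Disj \<phi> \<psi>) \<in> F \<longleftrightarrow> Neg \<phi> \<in> F \<and> Neg \<psi> \<in> F"
  using fragmentD(4)[of X F "CNeg Hole"] by simp

lemma fragment_Neg_Neg: "fragment X F \<Longrightarrow> Neg (Neg \<phi>) \<in> F \<Longrightarrow> \<phi> \<in> F"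
  using fragmentD(6)[of X F Hole] by simp

primrec quantify_ctx :: "quant \<Rightarrow> var \<Rightarrow> 'a ctx \<Rightarrow> 'a ctx" where
  "quantify_ctx QEx z \<mu> = CEx z \<mu>"
| "quantify_ctx QAll z \<mu> = CAll z \<mu>"
| "quantify_ctx QNegEx z \<mu> = CNeg (CEx z \<mu>)"
| "quantify_ctx QNegAll z \<mu> = CNeg (CAll z \<mu>)"

lemma quantify_fill: "quantify Q z (fill \<mu> \<phi>) = fill (quantify_ctx Q z \<mu>) \<phi>"
  by (cases Q) simp_all

text \<open>A context for the reduct becomes a context for F once it is placed under the quantifier,
  so each closure condition is inherited.\<close>

lemma fragment_reduct:
  assumes F: "fragment X F" and ne: "reduct Q z F \<noteq> {}"
  shows "fragment X (reduct Q z F)"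
proof -
  have mem: "fill \<mu> \<phi> \<in> reduct Q z F \<longleftrightarrow> fill (quantify_ctx Q z \<mu>) \<phi> \<in> F" for \<mu> \<phi>
    by (simp add: reduct_def quantify_fill)
  note D = fragmentD[OF F]
  show ?thesis
    unfolding fragment_def mem D(4,5,9)
    by (intro conjI allI impI ballI refl ne; (elim conjE)?; erule D(1-3,6-8); assumption)
qed

text \<open>\<open>vars\<close> counts a quantified variable even if it does not occur below, so one
  formula in the reduct already shows z \<in> {x, y}.\<close>

lemma reduct_FO2:
  assumes "G \<subseteq> FO2 x y" "reduct Q z G \<noteq> {}"
  shows "reduct Q z G \<subseteq> FO2 x y" "z \<in> {x, y}"
proof -
  have v: "vars \<phi> \<subseteq> {x, y} \<and> z \<in> {x, y}" if "\<phi> \<in> reduct Q z G" for \<phi>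
  proof -
    have "vars (quantify Q z \<phi>) \<subseteq> {x, y}" using that assms(1) by (auto simp: reduct_def FO2_def)
    then show ?thesis by (cases Q) auto
  qed
  then show "reduct Q z G \<subseteq> FO2 x y" unfolding FO2_def by blast
  show "z \<in> {x, y}" using v assms(2) by blast
qed

section \<open>From strategies to formulas\<close>

text \<open>Equality of the domains is carried along because \<open>spoiler_won\<close> tests free
  variables against the first valuation only, and negated quantifiers exchange the two.\<close>

lemma play_invariant:
  assumes F: "fragment X F"
  shows "play s F u v h c \<Longrightarrow>
    (case c of (G, (u', \<alpha>), (v', \<beta>)) \<Rightarrow> fragment X G \<and> dom \<alpha> = dom \<beta>)"
proof (induction rule: play.induct)
  case start
  then show ?case using F by (simp add: initial_config_def)
next
  case (round h c m)
  obtain G u' \<alpha> v' \<beta> where c: "c = (G, (u', \<alpha>), (v', \<beta>))" by (metis prod.exhaust)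
  obtain Q z q where m: "m = (Q, z, q)" by (metis prod.exhaust)
  show ?case
    using round fragment_reduct[of X G Q z] unfolding c m by (cases Q) auto
qed

lemma winning_strategy_round:
  assumes "winning_strategy F u v s" "play s F u v h c" "legal_challenge c m"
  obtains r where "legal_answer c m r" "play s F u v (h @ [(m, r)]) (next_config c m r)"
  using assms play.round[OF assms(2) _ assms(3)] that[of "s h m"]
  unfolding winning_strategy_def by blast

text \<open>Preservation runs one way, so the claim for \<open>Neg \<psi>\<close> does not follow
  from the one for \<psi>. Closure of fragments pushes negations inward instead, which calls for
  induction on size; at each quantifier one round is played.\<close>

lemma winning_strategy_preserves:
  assumes win: "winning_strategy F u v s" and F: "fragment X F"
  shows "play s F u v h (G, (u', \<alpha>), (v', \<beta>)) \<Longrightarrow> \<phi> \<in> G \<Longrightarrow> FV \<phi> \<subseteq> dom \<alpha> \<Longrightarrow>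
    sat u' \<alpha> \<phi> \<Longrightarrow> sat v' \<beta> \<phi>"
proof (induction \<phi> arbitrary: h G u' \<alpha> v' \<beta> rule: measure_induct_rule[of size])
  case (less \<phi>)
  let ?c = "(G, (u', \<alpha>), (v', \<beta>))"
  have G: "fragment X G" and dom: "dom \<alpha> = dom \<beta>"
    using play_invariant[OF F less.prems(1)] by simp_all
  have "\<not> spoiler_won ?c"
    using win less.prems(1) unfolding winning_strategy_def by blast
  then have qf: ?case if "quantifier_free \<phi>"
    using that less.prems by auto
  have IH: "sat v' \<beta> \<psi>" if "size \<psi> < size \<phi>" "\<psi> \<in> G" "FV \<psi> \<subseteq> FV \<phi>" "sat u' \<alpha> \<psi>" for \<psi>
    using less.IH[OF that(1) less.prems(1) that(2) _ that(4)] that(3) less.prems(3) by blast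
  have mem: "\<psi> \<in> reduct Q z G" if "\<phi> = quantify Q z \<psi>" for Q z \<psi>
    using less.prems(2) that by (simp add: reduct_def)
  note round = winning_strategy_round[OF win less.prems(1)]
  consider "quantifier_free \<phi>" | \<psi> \<chi> where "\<phi> = Disj \<psi> \<chi>" | \<psi> \<chi> where "\<phi> = Conj \<psi> \<chi>"
    | z \<psi> where "\<phi> = Ex z \<psi>" | z \<psi> where "\<phi> = All z \<psi>"
    | \<psi> \<chi> where "\<phi> = Neg (Disj \<psi> \<chi>)" | \<psi> \<chi> where "\<phi> = Neg (Conj \<psi> \<chi>)"
    | z \<psi> where "\<phi> = Neg (Ex z \<psi>)" | z \<psi> where "\<phi> = Neg (All z \<psi>)"
    | \<psi> where "\<phi> = Neg (Neg \<psi>)"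
  proof (cases \<phi>)
    case (Neg \<psi>)
    then show ?thesis using that by (cases \<psi>) auto
  qed (use that in auto)
  then show ?case
  proof cases
    case 1
    then show ?thesis by (rule qf)
  next
    case (2 \<psi> \<chi>)
    then show ?thesis
      using IH[of \<psi>] IH[of \<chi>] less.prems fragment_Disj[OF G] by auto
  next
    case (3 \<psi> \<chi>)
    then show ?thesis
      using IH[of \<psi>] IH[of \<chi>] less.prems fragment_Conj[OF G] by auto
  next
    case (4 z \<psi>)
    then obtain q where q: "q \<in> positions u'" "sat u' (\<alpha>(z \<mapsto> q)) \<psi>" using less.prems by auto
    have \<psi>: "\<psi> \<in> reduct QEx z G" using mem[of QEx z \<psi>] 4 by simp
    then have "legal_challenge ?c (QEx, z, q)" using q by auto
    then obtain r where r: "r \<in> positions v'"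
      "play s F u v (h @ [((QEx, z, q), r)]) (reduct QEx z G, (u', \<alpha>(z \<mapsto> q)), (v', \<beta>(z \<mapsto> r)))"
      by (rule round) (simp split: quant.splits)
    have "sat v' (\<beta>(z \<mapsto> r)) \<psi>"
      by (rule less.IH[OF _ r(2) \<psi> _ q(2)]) (use 4 less.prems in auto)
    then show ?thesis using r(1) 4 by auto
  next
    case (5 z \<psi>)
    have \<psi>: "\<psi> \<in> reduct QAll z G" using mem[of QAll z \<psi>] 5 by simp
    have "sat v' (\<beta>(z \<mapsto> q)) \<psi>" if q: "q \<in> positions v'" for q
    proof -
      have "legal_challenge ?c (QAll, z, q)" using q \<psi> by auto
      then obtain r where r: "r \<in> positions u'"
        "play s F u v (h @ [((QAll, z, q), r)]) (reduct QAll z G, (u', \<alpha>(z \<mapsto> r)), (v', \<beta>(z \<mapsto> q)))"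
        by (rule round) (simp split: quant.splits)
      show ?thesis
        by (rule less.IH[OF _ r(2) \<psi>]) (use 5 less.prems r(1) in \<open>auto simp del: fun_upd_apply\<close>)
    qed
    then show ?thesis using 5 by simp
  next
    case (6 \<psi> \<chi>)
    then show ?thesis
      using IH[of "Neg \<psi>"] IH[of "Neg \<chi>"] less.prems fragment_Neg_Disj[OF G] by auto
  next
    case (7 \<psi> \<chi>)
    then show ?thesis
      using IH[of "Neg \<psi>"] IH[of "Neg \<chi>"] less.prems fragment_Neg_Conj[OF G] by auto
  next
    case (8 z \<psi>)
    have \<psi>: "\<psi> \<in> reduct QNegEx z G" using mem[of QNegEx z \<psi>] 8 by simp
    have "\<not> sat v' (\<beta>(z \<mapsto> q)) \<psi>" if q: "q \<in> positions v'" for q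
    proof
      assume sat: "sat v' (\<beta>(z \<mapsto> q)) \<psi>"
      have "legal_challenge ?c (QNegEx, z, q)" using q \<psi> by auto
      then obtain r where r: "r \<in> positions u'"
        "play s F u v (h @ [((QNegEx, z, q), r)]) (reduct QNegEx z G, (v', \<beta>(z \<mapsto> q)), (u', \<alpha>(z \<mapsto> r)))"
        by (rule round) (simp split: quant.splits)
      have "sat u' (\<alpha>(z \<mapsto> r)) \<psi>"
        by (rule less.IH[OF _ r(2) \<psi> _ sat]) (use 8 less.prems dom in auto)
      then show False using 8 less.prems r(1) by auto
    qed
    then show ?thesis using 8 by simp
  next
    case (9 z \<psi>)
    have \<psi>: "\<psi> \<in> reduct QNegAll z G" using mem[of QNegAll z \<psi>] 9 by simp
    obtain q where q: "q \<in> positions u'" "\<not> sat u' (\<alpha>(z \<mapsto> q)) \<psi>" using 9 less.prems by auto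
    then have "legal_challenge ?c (QNegAll, z, q)" using \<psi> by auto
    then obtain r where r: "r \<in> positions v'"
      "play s F u v (h @ [((QNegAll, z, q), r)]) (reduct QNegAll z G, (v', \<beta>(z \<mapsto> r)), (u', \<alpha>(z \<mapsto> q)))"
      by (rule round) (simp split: quant.splits)
    \<comment> \<open>The round exchanged the words, so the induction hypothesis leads from v' to
      u'; its contrapositive makes \<psi> fail at r.\<close>
    have "sat u' (\<alpha>(z \<mapsto> q)) \<psi>" if sat: "sat v' (\<beta>(z \<mapsto> r)) \<psi>"
      by (rule less.IH[OF _ r(2) \<psi> _ sat]) (use 9 less.prems dom in auto)
    then show ?thesis using r(1) q(2) 9 by auto
  next
    case (10 \<psi>)
    then show ?thesis
      using IH[of \<psi>] less.prems fragment_Neg_Neg[OF G, of \<psi>] by auto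
  qed
qed

section \<open>From formulas to strategies\<close>

text \<open>A strategy sees the history and not the configuration; \<open>conf\<close> recovers the
  latter by replaying the rounds.\<close>

lemma invariant_winning_strategy:
  assumes "I (initial_config F u v)" and "\<And>c. I c \<Longrightarrow> \<not> spoiler_won c"
    and answer: "\<And>c m. I c \<Longrightarrow> legal_challenge c m \<Longrightarrow> \<exists>r. legal_answer c m r \<and> I (next_config c m r)"
  shows "\<exists>s. winning_strategy F u v s"
proof -
  define conf where "conf = foldl (\<lambda>c (m, r). next_config c m r) (initial_config F u v)"
  define s where "s h m = (SOME r. legal_answer (conf h) m r \<and> I (next_config (conf h) m r))" for h m
  have conf: "conf [] = initial_config F u v" "conf (h @ [(m, r)]) = next_config (conf h) m r" for h m r
    by (simp_all add: conf_def)
  have s: "legal_answer (conf h) m (s h m) \<and> I (next_config (conf h) m (s h m))"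
    if "I (conf h)" "legal_challenge (conf h) m" for h m
    unfolding s_def by (rule someI_ex) (rule answer[OF that])
  have "c = conf h \<and> I c" if "play s F u v h c" for h c
    using that
  proof (induction rule: play.induct)
    case start
    then show ?case using assms(1) by (simp add: conf)
  next
    case (round h c m)
    then have "c = conf h" "I c" by blast+
    then show ?case using s[of h m] round.hyps(3) by (simp add: conf)
  qed
  then have "winning_strategy F u v s"
    unfolding winning_strategy_def using assms(2) s by blast
  then show ?thesis by blast
qed

section \<open>Duplicator's answers by compactness\<close>

lemma finite_conjunction:
  assumes "finite \<Psi>" "\<Psi> \<subseteq> \<Phi>" "Top \<in> \<Phi>" "\<And>\<phi> \<psi>. \<phi> \<in> \<Phi> \<Longrightarrow> \<psi> \<in> \<Phi> \<Longrightarrow> Conj \<phi> \<psi> \<in> \<Phi>"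
  shows "\<exists>\<chi>\<in>\<Phi>. \<forall>\<alpha>. sat w \<alpha> \<chi> \<longleftrightarrow> (\<forall>\<phi>\<in>\<Psi>. sat w \<alpha> \<phi>)"
  using assms(1,2)
proof (induction rule: finite_induct)
  case empty
  show ?case using assms(3) by (intro bexI[of _ Top]) simp_all
next
  case (insert \<psi> \<Psi>)
  then obtain \<chi> where "\<chi> \<in> \<Phi>" "\<forall>\<alpha>. sat w \<alpha> \<chi> \<longleftrightarrow> (\<forall>\<phi>\<in>\<Psi>. sat w \<alpha> \<phi>)" by auto
  then show ?case
    using assms(4)[of \<psi> \<chi>] insert.prems by (intro bexI[of _ "Conj \<psi> \<chi>"]) auto
qed

lemma finite_disjunction:
  assumes "finite \<Psi>" "\<Psi> \<subseteq> \<Phi>" "Bot \<in> \<Phi>" "\<And>\<phi> \<psi>. \<phi> \<in> \<Phi> \<Longrightarrow> \<psi> \<in> \<Phi> \<Longrightarrow> Disj \<phi> \<psi> \<in> \<Phi>"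
  shows "\<exists>\<chi>\<in>\<Phi>. \<forall>\<alpha>. sat w \<alpha> \<chi> \<longleftrightarrow> (\<exists>\<phi>\<in>\<Psi>. sat w \<alpha> \<phi>)"
  using assms(1,2)
proof (induction rule: finite_induct)
  case empty
  show ?case using assms(3) by (intro bexI[of _ Bot]) simp_all
next
  case (insert \<psi> \<Psi>)
  then obtain \<chi> where "\<chi> \<in> \<Phi>" "\<forall>\<alpha>. sat w \<alpha> \<chi> \<longleftrightarrow> (\<exists>\<phi>\<in>\<Psi>. sat w \<alpha> \<phi>)" by auto
  then show ?case
    using assms(4)[of \<psi> \<chi>] insert.prems by (intro bexI[of _ "Disj \<psi> \<chi>"]) auto
qed

text \<open>If each answer missed a formula true at the quest, all answers would miss one finite
  conjunction of such formulas. The premise \<open>no\<close> excludes this; it will come from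
  preservation of \<open>Ex z \<chi>\<close> or, when the words swap, of its negation.\<close>

lemma answer_above:
  assumes w: "tame w" and G: "fragment X G" "G \<subseteq> FO2 x y" and z: "z \<in> {x, y}"
    and ran: "ran \<alpha> \<subseteq> positions w"
    and no: "\<And>\<chi>. \<chi> \<in> G \<Longrightarrow> FV \<chi> \<subseteq> insert z (dom \<alpha>) \<Longrightarrow> sat w' \<beta> \<chi> \<Longrightarrow>
      \<exists>p\<in>positions w. sat w (\<alpha>(z \<mapsto> p)) \<chi>"
  shows "\<exists>p\<in>positions w. \<forall>\<phi>\<in>G. FV \<phi> \<subseteq> insert z (dom \<alpha>) \<longrightarrow> sat w' \<beta> \<phi> \<longrightarrow> sat w (\<alpha>(z \<mapsto> p)) \<phi>"
proof (rule ccontr)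
  assume neg: "\<not> ?thesis"
  let ?\<Phi> = "{\<phi> \<in> G. FV \<phi> \<subseteq> insert z (dom \<alpha>) \<and> sat w' \<beta> \<phi>}"
  have vars: "vars \<phi> \<subseteq> {x, y}" "FV \<phi> \<subseteq> insert z (dom \<alpha>)" if "\<phi> \<in> ?\<Phi>" for \<phi>
    using that G(2) by (auto simp: FO2_def)
  have bad: "\<forall>p\<in>positions w. \<exists>\<phi>\<in>?\<Phi>. \<not> sat w (\<alpha>(z \<mapsto> p)) \<phi>"
    using neg by blast
  have "\<exists>\<Psi>\<subseteq>?\<Phi>. finite \<Psi> \<and> (\<forall>p\<in>positions w. \<exists>\<phi>\<in>\<Psi>. \<not> sat w (\<alpha>(z \<mapsto> p)) \<phi>)"
    by (rule FO2_compact[OF w vars(1) z vars(2) ran bad])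
  then obtain \<Psi> where \<Psi>: "\<Psi> \<subseteq> ?\<Phi>" "finite \<Psi>" "\<forall>p\<in>positions w. \<exists>\<phi>\<in>\<Psi>. \<not> sat w (\<alpha>(z \<mapsto> p)) \<phi>"
    by (elim exE conjE)
  have "\<exists>\<chi>\<in>?\<Phi>. \<forall>\<alpha>. sat w \<alpha> \<chi> \<longleftrightarrow> (\<forall>\<phi>\<in>\<Psi>. sat w \<alpha> \<phi>)"
    by (rule finite_conjunction[OF \<Psi>(2,1)])
      (simp_all add: fragment_Top[OF G(1)] fragment_Conj[OF G(1)])
  then obtain \<chi> where \<chi>: "\<chi> \<in> ?\<Phi>" "\<forall>\<alpha>. sat w \<alpha> \<chi> \<longleftrightarrow> (\<forall>\<phi>\<in>\<Psi>. sat w \<alpha> \<phi>)"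
    by (elim bexE)
  then obtain p where "p \<in> positions w" "sat w (\<alpha>(z \<mapsto> p)) \<chi>" using no[of \<chi>] by auto
  then show False using \<Psi>(3) \<chi>(2) by blast
qed

text \<open>Dually, the answer must falsify every formula that is false at the quest. Compactness is
  applied to the negations, which may lie outside G; a finite disjunction of the original formulas
  then leads back into G.\<close>

lemma answer_below:
  assumes w: "tame w" and G: "fragment X G" "G \<subseteq> FO2 x y" and z: "z \<in> {x, y}"
    and ran: "ran \<alpha> \<subseteq> positions w"
    and no: "\<And>\<chi>. \<chi> \<in> G \<Longrightarrow> FV \<chi> \<subseteq> insert z (dom \<alpha>) \<Longrightarrow> \<forall>p\<in>positions w. sat w (\<alpha>(z \<mapsto> p)) \<chi> \<Longrightarrow>
      sat w' \<beta> \<chi>"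
  shows "\<exists>p\<in>positions w. \<forall>\<phi>\<in>G. FV \<phi> \<subseteq> insert z (dom \<alpha>) \<longrightarrow> sat w (\<alpha>(z \<mapsto> p)) \<phi> \<longrightarrow> sat w' \<beta> \<phi>"
proof (rule ccontr)
  assume neg: "\<not> ?thesis"
  let ?\<Phi> = "{\<phi> \<in> G. FV \<phi> \<subseteq> insert z (dom \<alpha>) \<and> \<not> sat w' \<beta> \<phi>}"
  have vars: "vars \<phi> \<subseteq> {x, y}" "FV \<phi> \<subseteq> insert z (dom \<alpha>)" if "\<phi> \<in> Neg ` ?\<Phi>" for \<phi>
  proof -
    obtain \<psi> where "\<phi> = Neg \<psi>" "\<psi> \<in> ?\<Phi>" using \<open>\<phi> \<in> Neg ` ?\<Phi>\<close> by blast
    moreover from this have "\<psi> \<in> FO2 x y" using G(2) by blast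
    ultimately show "vars \<phi> \<subseteq> {x, y}" "FV \<phi> \<subseteq> insert z (dom \<alpha>)"
      by (simp_all add: FO2_def)
  qed
  have bad: "\<forall>p\<in>positions w. \<exists>\<phi>\<in>Neg ` ?\<Phi>. \<not> sat w (\<alpha>(z \<mapsto> p)) \<phi>"
  proof
    fix p assume "p \<in> positions w"
    then obtain \<phi> where "\<phi> \<in> ?\<Phi>" "sat w (\<alpha>(z \<mapsto> p)) \<phi>" using neg by blast
    then show "\<exists>\<phi>\<in>Neg ` ?\<Phi>. \<not> sat w (\<alpha>(z \<mapsto> p)) \<phi>" by (intro bexI[of _ "Neg \<phi>"]) auto
  qed
  have "\<exists>\<Psi>'\<subseteq>Neg ` ?\<Phi>. finite \<Psi>' \<and> (\<forall>p\<in>positions w. \<exists>\<phi>\<in>\<Psi>'. \<not> sat w (\<alpha>(z \<mapsto> p)) \<phi>)"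
    by (rule FO2_compact[OF w vars(1) z vars(2) ran bad])
  then obtain \<Psi>' where \<Psi>': "\<Psi>' \<subseteq> Neg ` ?\<Phi>" "finite \<Psi>'"
      "\<forall>p\<in>positions w. \<exists>\<phi>\<in>\<Psi>'. \<not> sat w (\<alpha>(z \<mapsto> p)) \<phi>"
    by (elim exE conjE)
  obtain \<Psi> where \<Psi>: "\<Psi> \<subseteq> ?\<Phi>" "finite \<Psi>" "\<Psi>' = Neg ` \<Psi>"
    using finite_subset_image[OF \<Psi>'(2,1)] by blast
  have "\<exists>\<chi>\<in>?\<Phi>. \<forall>\<alpha>. sat w \<alpha> \<chi> \<longleftrightarrow> (\<exists>\<phi>\<in>\<Psi>. sat w \<alpha> \<phi>)"
    by (rule finite_disjunction[OF \<Psi>(2,1)])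
      (simp_all add: fragment_Bot[OF G(1)] fragment_Disj[OF G(1)])
  then obtain \<chi> where \<chi>: "\<chi> \<in> ?\<Phi>" "\<forall>\<alpha>. sat w \<alpha> \<chi> \<longleftrightarrow> (\<exists>\<phi>\<in>\<Psi>. sat w \<alpha> \<phi>)"
    by (elim bexE)
  have "\<forall>p\<in>positions w. sat w (\<alpha>(z \<mapsto> p)) \<chi>"
    using \<Psi>'(3) \<chi>(2) unfolding \<Psi>(3) by auto
  then show False using no[of \<chi>] \<chi>(1) by blast
qed

fun duplicator_safe :: "var \<Rightarrow> var \<Rightarrow> ('p, 'a) config \<Rightarrow> bool" where
  "duplicator_safe x y (G, (u, \<alpha>), (v, \<beta>)) \<longleftrightarrow>
     fragment {x, y} G \<and> G \<subseteq> FO2 x y \<and> dom \<alpha> = dom \<beta> \<and> tame u \<and> tame v \<and>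
     ran \<alpha> \<subseteq> positions u \<and> ran \<beta> \<subseteq> positions v \<and>
     (\<forall>\<phi>\<in>G. FV \<phi> \<subseteq> dom \<alpha> \<longrightarrow> sat u \<alpha> \<phi> \<longrightarrow> sat v \<beta> \<phi>)"

lemma ran_upd: "ran f \<subseteq> A \<Longrightarrow> p \<in> A \<Longrightarrow> ran (f(z \<mapsto> p)) \<subseteq> A"
  by (auto simp: ran_def)

text \<open>In the new configuration the quest belongs to the first word for \<open>QEx\<close> and
  \<open>QNegEx\<close>, the case of \<open>answer_above\<close>, and to the second word for
  \<open>QAll\<close> and \<open>QNegAll\<close>, the case of \<open>answer_below\<close>.\<close>

lemma duplicator_safe_answer:
  assumes safe: "duplicator_safe x y c" and legal: "legal_challenge c m"
  shows "\<exists>r. legal_answer c m r \<and> duplicator_safe x y (next_config c m r)"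
proof -
  obtain G u \<alpha> v \<beta> where c: "c = (G, (u, \<alpha>), (v, \<beta>))" by (metis prod.exhaust)
  obtain Q z q where m: "m = (Q, z, q)" by (metis prod.exhaust)
  let ?G = "reduct Q z G"
  have ne: "?G \<noteq> {}" using legal c m by auto
  have G: "fragment {x, y} G" "G \<subseteq> FO2 x y" and dom: "dom \<alpha> = dom \<beta>" and tame: "tame u" "tame v"
    and ran: "ran \<alpha> \<subseteq> positions u" "ran \<beta> \<subseteq> positions v"
    and pres: "\<And>\<phi>. \<phi> \<in> G \<Longrightarrow> FV \<phi> \<subseteq> dom \<alpha> \<Longrightarrow> sat u \<alpha> \<phi> \<Longrightarrow> sat v \<beta> \<phi>"
    using safe unfolding c by auto
  have G': "fragment {x, y} ?G" "?G \<subseteq> FO2 x y" and z: "z \<in> {x, y}"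
    using fragment_reduct[OF G(1) ne] reduct_FO2[OF G(2) ne] by auto
  have mem: "quantify Q z \<phi> \<in> G" if "\<phi> \<in> ?G" for \<phi>
    using that by (simp add: reduct_def)
  show ?thesis
  proof (cases Q)
    case QEx
    then have q: "q \<in> positions u" using legal c m by auto
    have "\<exists>r\<in>positions v. \<forall>\<phi>\<in>?G. FV \<phi> \<subseteq> insert z (dom \<beta>) \<longrightarrow>
        sat u (\<alpha>(z \<mapsto> q)) \<phi> \<longrightarrow> sat v (\<beta>(z \<mapsto> r)) \<phi>"
    proof (rule answer_above[OF tame(2) G' z ran(2)])
      fix \<chi> assume "\<chi> \<in> ?G" "FV \<chi> \<subseteq> insert z (dom \<beta>)" "sat u (\<alpha>(z \<mapsto> q)) \<chi>"
      then show "\<exists>r\<in>positions v. sat v (\<beta>(z \<mapsto> r)) \<chi>"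
        using pres[of "Ex z \<chi>"] mem[of \<chi>] q dom QEx by auto
    qed
    then obtain r where r: "r \<in> positions v"
      "\<forall>\<phi>\<in>?G. FV \<phi> \<subseteq> insert z (dom \<beta>) \<longrightarrow>
        sat u (\<alpha>(z \<mapsto> q)) \<phi> \<longrightarrow> sat v (\<beta>(z \<mapsto> r)) \<phi>"
      by (elim bexE)
    show ?thesis
      using QEx q G' tame r dom ran_upd[OF ran(1) q] ran_upd[OF ran(2) r(1)]
      unfolding c m by (intro exI[of _ r]) (simp del: fun_upd_apply)
  next
    case QAll
    then have q: "q \<in> positions v" using legal c m by auto
    have "\<exists>r\<in>positions u. \<forall>\<phi>\<in>?G. FV \<phi> \<subseteq> insert z (dom \<alpha>) \<longrightarrow>
        sat u (\<alpha>(z \<mapsto> r)) \<phi> \<longrightarrow> sat v (\<beta>(z \<mapsto> q)) \<phi>"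
    proof (rule answer_below[OF tame(1) G' z ran(1)])
      fix \<chi> assume "\<chi> \<in> ?G" "FV \<chi> \<subseteq> insert z (dom \<alpha>)" "\<forall>r\<in>positions u. sat u (\<alpha>(z \<mapsto> r)) \<chi>"
      then show "sat v (\<beta>(z \<mapsto> q)) \<chi>"
        using pres[of "All z \<chi>"] mem[of \<chi>] q dom QAll by auto
    qed
    then obtain r where r: "r \<in> positions u"
      "\<forall>\<phi>\<in>?G. FV \<phi> \<subseteq> insert z (dom \<alpha>) \<longrightarrow>
        sat u (\<alpha>(z \<mapsto> r)) \<phi> \<longrightarrow> sat v (\<beta>(z \<mapsto> q)) \<phi>"
      by (elim bexE)
    show ?thesis
      using QAll q G' tame r dom ran_upd[OF ran(2) q] ran_upd[OF ran(1) r(1)]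
      unfolding c m by (intro exI[of _ r]) (simp del: fun_upd_apply)
  next
    case QNegEx
    then have q: "q \<in> positions v" using legal c m by auto
    have "\<exists>r\<in>positions u. \<forall>\<phi>\<in>?G. FV \<phi> \<subseteq> insert z (dom \<alpha>) \<longrightarrow>
        sat v (\<beta>(z \<mapsto> q)) \<phi> \<longrightarrow> sat u (\<alpha>(z \<mapsto> r)) \<phi>"
    proof (rule answer_above[OF tame(1) G' z ran(1)])
      fix \<chi> assume "\<chi> \<in> ?G" "FV \<chi> \<subseteq> insert z (dom \<alpha>)" "sat v (\<beta>(z \<mapsto> q)) \<chi>"
      then show "\<exists>r\<in>positions u. sat u (\<alpha>(z \<mapsto> r)) \<chi>"
        using pres[of "Neg (Ex z \<chi>)"] mem[of \<chi>] q dom QNegEx by auto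
    qed
    then obtain r where r: "r \<in> positions u"
      "\<forall>\<phi>\<in>?G. FV \<phi> \<subseteq> insert z (dom \<alpha>) \<longrightarrow>
        sat v (\<beta>(z \<mapsto> q)) \<phi> \<longrightarrow> sat u (\<alpha>(z \<mapsto> r)) \<phi>"
      by (elim bexE)
    show ?thesis
      using QNegEx q G' tame r dom ran_upd[OF ran(2) q] ran_upd[OF ran(1) r(1)]
      unfolding c m by (intro exI[of _ r]) (simp del: fun_upd_apply)
  next
    case QNegAll
    then have q: "q \<in> positions u" using legal c m by auto
    have "\<exists>r\<in>positions v. \<forall>\<phi>\<in>?G. FV \<phi> \<subseteq> insert z (dom \<beta>) \<longrightarrow>
        sat v (\<beta>(z \<mapsto> r)) \<phi> \<longrightarrow> sat u (\<alpha>(z \<mapsto> q)) \<phi>"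
    proof (rule answer_below[OF tame(2) G' z ran(2)])
      fix \<chi> assume "\<chi> \<in> ?G" "FV \<chi> \<subseteq> insert z (dom \<beta>)" "\<forall>r\<in>positions v. sat v (\<beta>(z \<mapsto> r)) \<chi>"
      then show "sat u (\<alpha>(z \<mapsto> q)) \<chi>"
        using pres[of "Neg (All z \<chi>)"] mem[of \<chi>] q dom QNegAll by auto
    qed
    then obtain r where r: "r \<in> positions v"
      "\<forall>\<phi>\<in>?G. FV \<phi> \<subseteq> insert z (dom \<beta>) \<longrightarrow>
        sat v (\<beta>(z \<mapsto> r)) \<phi> \<longrightarrow> sat u (\<alpha>(z \<mapsto> q)) \<phi>"
      by (elim bexE)
    show ?thesis
      using QNegAll q G' tame r dom ran_upd[OF ran(1) q] ran_upd[OF ran(2) r(1)]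
      unfolding c m by (intro exI[of _ r]) (simp del: fun_upd_apply)
  qed
qed

theorem theorem3:
  fixes F :: "'a fm set" and x y :: var and u v :: "(nat, 'a) word"
  assumes "x \<noteq> y"
    and "F \<subseteq> FO2 x y"
    and "fragment {x, y} F"
    and "sigma_rational u"
    and "sigma_rational v"
  shows "(\<forall>\<phi>\<in>F. FV \<phi> = {} \<longrightarrow> models u \<phi> \<longrightarrow> models v \<phi>) \<longleftrightarrow>
         (\<exists>s. winning_strategy F u v s)"
proof
  assume "\<forall>\<phi>\<in>F. FV \<phi> = {} \<longrightarrow> models u \<phi> \<longrightarrow> models v \<phi>"
  \<comment> \<open>The empty valuations restrict the preservation clause to sentences.\<close>
  then have "duplicator_safe x y (initial_config F u v)"
    using assms(2,3) sigma_rational_tame[OF assms(4)] sigma_rational_tame[OF assms(5)]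
    by (simp add: initial_config_def models_def)
  moreover have "\<not> spoiler_won c" if "duplicator_safe x y c" for c :: "(nat, 'a) config"
  proof -
    obtain G u \<alpha> v \<beta> where c: "c = (G, (u, \<alpha>), (v, \<beta>))" by (metis prod.exhaust)
    show ?thesis using that unfolding c by auto
  qed
  ultimately show "\<exists>s. winning_strategy F u v s"
    by (rule invariant_winning_strategy) (assumption | rule duplicator_safe_answer)+
next
  assume "\<exists>s. winning_strategy F u v s"
  then obtain s where s: "winning_strategy F u v s" ..
  show "\<forall>\<phi>\<in>F. FV \<phi> = {} \<longrightarrow> models u \<phi> \<longrightarrow> models v \<phi>"
    using winning_strategy_preserves[OF s assms(3) play.start[unfolded initial_config_def]]
    unfolding models_def by auto
qed

end
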